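(* Let $I\subsetneq\mathbb F\langle x,x^*\rangle$ be a proper $*$-ideal generated (as a $*$-ideal) by homogeneous analytic polynomials. Then there exist a Hilbert space $\mathcal H$ and a tuple $X=(X_1,\dots,X_g)$ of bounded operators on $\mathcal H$ such that for every $p\in\mathbb F\langle x,x^*\rangle$, $p(X)=0$ if and only if $p\in I$. In particular $\sqrt[\mathrm{hard}]{I}=I$.
   Context: $\mathbb F\in\{\mathbb R,\mathbb C\}$. $\mathbb F\langle x,x^*\rangle$ is the free $*$-algebra: polynomials in the $2g$ freely noncommuting letters $x_1,\dots,x_g,x_1^*,\dots,x_g^*$ over $\mathbb F$, with involution conjugating coefficients, reversing words and interchanging $x_j\leftrightarrow x_j^*$. A polynomial is analytic if it contains no letter $x_j^*$; it is homogeneous if it is a linear combination of words of the same length. A $*$-ideal is a two-sided ideal $I$ with $I^*=I$. For a tuple $X$ of operators (or matrices), $p(X)$ is obtained by substituting $X_j$ for $x_j$ and the adjoint $X_j^*$ for $x_j^*$. $\sqrt[\mathrm{hard}]{I}$ is the set of $p$ with $p(X)=0$ for every $n\ge1$ and every $X\in M_n(\mathbb F)^g$ satisfying $q(X)=0$ for all $q\in I$. *)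

theory Defs
  imports Complex_Main
begin

text \<open>The field F is a type 'f of class real_normed_field together with its conjugation
  c (c = id for F = R, c = cnj for F = C). Letters: Lx j is x_j, Ls j is x_j^*.\<close>

datatype ltr = Lx nat | Ls nat

fun lidx :: "ltr \<Rightarrow> nat" where
  "lidx (Lx j) = j" | "lidx (Ls j) = j"

fun lstar :: "ltr \<Rightarrow> ltr" where
  "lstar (Lx j) = Ls j" | "lstar (Ls j) = Lx j"

fun is_analytic_letter :: "ltr \<Rightarrow> bool" where
  "is_analytic_letter (Lx j) = True" | "is_analytic_letter (Ls j) = False"

definition wstar :: "ltr list \<Rightarrow> ltr list" where
  "wstar w = rev (map lstar w)"

definition polys :: "nat \<Rightarrow> (ltr list \<Rightarrow> 'f::real_normed_field) set" where
  "polys g = {p. finite {w. p w \<noteq> 0} \<and> (\<forall>w. p w \<noteq> 0 \<longrightarrow> (\<forall>l\<in>set w. lidx l < g))}"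

definition padd :: "(ltr list \<Rightarrow> 'f::real_normed_field) \<Rightarrow> (ltr list \<Rightarrow> 'f) \<Rightarrow> ltr list \<Rightarrow> 'f" where
  "padd p q = (\<lambda>w. p w + q w)"

definition pmult :: "(ltr list \<Rightarrow> 'f::real_normed_field) \<Rightarrow> (ltr list \<Rightarrow> 'f) \<Rightarrow> ltr list \<Rightarrow> 'f" where
  "pmult p q = (\<lambda>w. \<Sum>k\<le>length w. p (take k w) * q (drop k w))"

definition pstar :: "('f \<Rightarrow> 'f) \<Rightarrow> (ltr list \<Rightarrow> 'f::real_normed_field) \<Rightarrow> ltr list \<Rightarrow> 'f" where
  "pstar c p = (\<lambda>w. c (p (wstar w)))"

definition analytic :: "(ltr list \<Rightarrow> 'f::real_normed_field) \<Rightarrow> bool" where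
  "analytic p \<longleftrightarrow> (\<forall>w. p w \<noteq> 0 \<longrightarrow> (\<forall>l\<in>set w. is_analytic_letter l))"

definition homogeneous :: "(ltr list \<Rightarrow> 'f::real_normed_field) \<Rightarrow> bool" where
  "homogeneous p \<longleftrightarrow> (\<exists>d. \<forall>w. p w \<noteq> 0 \<longrightarrow> length w = d)"

definition star_ideal :: "nat \<Rightarrow> ('f \<Rightarrow> 'f) \<Rightarrow> (ltr list \<Rightarrow> 'f::real_normed_field) set \<Rightarrow> bool" where
  "star_ideal g c I \<longleftrightarrow> I \<subseteq> polys g \<and> (\<lambda>w. 0) \<in> I
     \<and> (\<forall>p\<in>I. \<forall>q\<in>I. padd p q \<in> I)
     \<and> (\<forall>p\<in>I. \<forall>a\<in>polys g. \<forall>b\<in>polys g. pmult a (pmult p b) \<in> I)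
     \<and> (\<forall>p\<in>I. pstar c p \<in> I)"

definition star_ideal_gen :: "nat \<Rightarrow> ('f \<Rightarrow> 'f) \<Rightarrow> (ltr list \<Rightarrow> 'f::real_normed_field) set
    \<Rightarrow> (ltr list \<Rightarrow> 'f) set" where
  "star_ideal_gen g c S = \<Inter>{I. star_ideal g c I \<and> S \<subseteq> I}"

definition hnorm :: "((nat \<Rightarrow> 'f) \<Rightarrow> (nat \<Rightarrow> 'f) \<Rightarrow> 'f::real_normed_field) \<Rightarrow> (nat \<Rightarrow> 'f) \<Rightarrow> real" where
  "hnorm ip u = sqrt (norm (ip u u))"

definition hilbert_space :: "('f \<Rightarrow> 'f) \<Rightarrow> (nat \<Rightarrow> 'f::real_normed_field) set
    \<Rightarrow> ((nat \<Rightarrow> 'f) \<Rightarrow> (nat \<Rightarrow> 'f) \<Rightarrow> 'f) \<Rightarrow> bool" where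
  "hilbert_space c V ip \<longleftrightarrow>
     (\<lambda>n. 0) \<in> V
   \<and> (\<forall>u\<in>V. \<forall>v\<in>V. (\<lambda>n. u n + v n) \<in> V)
   \<and> (\<forall>a. \<forall>u\<in>V. (\<lambda>n. a * u n) \<in> V)
   \<and> (\<forall>u\<in>V. \<forall>v\<in>V. \<forall>w\<in>V. ip (\<lambda>n. u n + v n) w = ip u w + ip v w)
   \<and> (\<forall>a. \<forall>u\<in>V. \<forall>v\<in>V. ip (\<lambda>n. a * u n) v = a * ip u v)
   \<and> (\<forall>u\<in>V. \<forall>v\<in>V. ip v u = c (ip u v))
   \<and> (\<forall>u\<in>V. \<exists>r::real. r \<ge> 0 \<and> ip u u = of_real r)
   \<and> (\<forall>u\<in>V. ip u u = 0 \<longrightarrow> u = (\<lambda>n. 0))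
   \<and> (\<forall>s. (\<forall>m. s m \<in> V) \<and>
          (\<forall>e>0. \<exists>N. \<forall>m\<ge>N. \<forall>k\<ge>N. hnorm ip (\<lambda>n. s m n - s k n) < e)
          \<longrightarrow> (\<exists>l\<in>V. (\<lambda>m. hnorm ip (\<lambda>n. s m n - l n)) \<longlonglongrightarrow> 0))"

definition bounded_op :: "(nat \<Rightarrow> 'f::real_normed_field) set \<Rightarrow> ((nat \<Rightarrow> 'f) \<Rightarrow> (nat \<Rightarrow> 'f) \<Rightarrow> 'f)
    \<Rightarrow> ((nat \<Rightarrow> 'f) \<Rightarrow> (nat \<Rightarrow> 'f)) \<Rightarrow> bool" where
  "bounded_op V ip T \<longleftrightarrow>
     (\<forall>u\<in>V. T u \<in> V)
   \<and> (\<forall>u\<in>V. \<forall>v\<in>V. T (\<lambda>n. u n + v n) = (\<lambda>n. T u n + T v n))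
   \<and> (\<forall>a. \<forall>u\<in>V. T (\<lambda>n. a * u n) = (\<lambda>n. a * T u n))
   \<and> (\<exists>K. \<forall>u\<in>V. hnorm ip (T u) \<le> K * hnorm ip u)"

definition is_adjoint :: "(nat \<Rightarrow> 'f::real_normed_field) set \<Rightarrow> ((nat \<Rightarrow> 'f) \<Rightarrow> (nat \<Rightarrow> 'f) \<Rightarrow> 'f)
    \<Rightarrow> ((nat \<Rightarrow> 'f) \<Rightarrow> (nat \<Rightarrow> 'f)) \<Rightarrow> ((nat \<Rightarrow> 'f) \<Rightarrow> (nat \<Rightarrow> 'f)) \<Rightarrow> bool" where
  "is_adjoint V ip T T' \<longleftrightarrow> (\<forall>u\<in>V. T' u \<in> V) \<and> (\<forall>u\<in>V. \<forall>v\<in>V. ip (T u) v = ip u (T' v))"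

text \<open>Evaluation of a word / polynomial at an operator tuple X with adjoints Y (Y j = X j^*).
  Word x_{i1}...x_{ik} is evaluated as the composition X_{i1} o ... o X_{ik}.\<close>

fun op_word :: "(nat \<Rightarrow> (nat \<Rightarrow> 'f) \<Rightarrow> (nat \<Rightarrow> 'f)) \<Rightarrow> (nat \<Rightarrow> (nat \<Rightarrow> 'f) \<Rightarrow> (nat \<Rightarrow> 'f))
    \<Rightarrow> ltr list \<Rightarrow> (nat \<Rightarrow> 'f) \<Rightarrow> (nat \<Rightarrow> 'f)" where
  "op_word X Y [] u = u"
| "op_word X Y (Lx j # w) u = X j (op_word X Y w u)"
| "op_word X Y (Ls j # w) u = Y j (op_word X Y w u)"

definition op_eval :: "(ltr list \<Rightarrow> 'f::real_normed_field) \<Rightarrow> (nat \<Rightarrow> (nat \<Rightarrow> 'f) \<Rightarrow> (nat \<Rightarrow> 'f))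
    \<Rightarrow> (nat \<Rightarrow> (nat \<Rightarrow> 'f) \<Rightarrow> (nat \<Rightarrow> 'f)) \<Rightarrow> (nat \<Rightarrow> 'f) \<Rightarrow> (nat \<Rightarrow> 'f)" where
  "op_eval p X Y u = (\<lambda>n. \<Sum>w\<in>{w. p w \<noteq> 0}. p w * op_word X Y w u n)"

text \<open>n x n matrices over F as functions nat => nat => F (only indices < n matter).\<close>

definition mmult :: "nat \<Rightarrow> (nat \<Rightarrow> nat \<Rightarrow> 'f::real_normed_field) \<Rightarrow> (nat \<Rightarrow> nat \<Rightarrow> 'f) \<Rightarrow> nat \<Rightarrow> nat \<Rightarrow> 'f" where
  "mmult n A B = (\<lambda>i j. \<Sum>k<n. A i k * B k j)"

definition madj :: "('f \<Rightarrow> 'f) \<Rightarrow> (nat \<Rightarrow> nat \<Rightarrow> 'f::real_normed_field) \<Rightarrow> nat \<Rightarrow> nat \<Rightarrow> 'f" where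
  "madj c A = (\<lambda>i j. c (A j i))"

fun mat_word :: "nat \<Rightarrow> ('f \<Rightarrow> 'f) \<Rightarrow> (nat \<Rightarrow> nat \<Rightarrow> nat \<Rightarrow> 'f::real_normed_field) \<Rightarrow> ltr list
    \<Rightarrow> nat \<Rightarrow> nat \<Rightarrow> 'f" where
  "mat_word n c X [] = (\<lambda>i j. if i = j then 1 else 0)"
| "mat_word n c X (Lx k # w) = mmult n (X k) (mat_word n c X w)"
| "mat_word n c X (Ls k # w) = mmult n (madj c (X k)) (mat_word n c X w)"

definition mat_eval :: "nat \<Rightarrow> ('f \<Rightarrow> 'f) \<Rightarrow> (ltr list \<Rightarrow> 'f::real_normed_field)
    \<Rightarrow> (nat \<Rightarrow> nat \<Rightarrow> nat \<Rightarrow> 'f) \<Rightarrow> nat \<Rightarrow> nat \<Rightarrow> 'f" where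
  "mat_eval n c p X = (\<lambda>i j. \<Sum>w\<in>{w. p w \<noteq> 0}. p w * mat_word n c X w i j)"

definition mat_zero :: "nat \<Rightarrow> (nat \<Rightarrow> nat \<Rightarrow> 'f::real_normed_field) \<Rightarrow> bool" where
  "mat_zero n A \<longleftrightarrow> (\<forall>i<n. \<forall>j<n. A i j = 0)"

definition hard_rad :: "nat \<Rightarrow> ('f \<Rightarrow> 'f) \<Rightarrow> (ltr list \<Rightarrow> 'f::real_normed_field) set
    \<Rightarrow> (ltr list \<Rightarrow> 'f) set" where
  "hard_rad g c I = {p \<in> polys g. \<forall>n\<ge>1. \<forall>X::nat \<Rightarrow> nat \<Rightarrow> nat \<Rightarrow> 'f.
      (\<forall>q\<in>I. mat_zero n (mat_eval n c q X)) \<longrightarrow> mat_zero n (mat_eval n c p X)}"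

definition hyp_1_4 :: "nat \<Rightarrow> ('f \<Rightarrow> 'f) \<Rightarrow> (ltr list \<Rightarrow> 'f::real_normed_field) set \<Rightarrow> bool" where
  "hyp_1_4 g c I \<longleftrightarrow>
     (\<exists>S. S \<subseteq> polys g \<and> (\<forall>s\<in>S. analytic s \<and> homogeneous s) \<and> I = star_ideal_gen g c S)
     \<and> I \<noteq> polys g"

definition concl_1_4 :: "nat \<Rightarrow> ('f \<Rightarrow> 'f) \<Rightarrow> (ltr list \<Rightarrow> 'f::real_normed_field) set \<Rightarrow> bool" where
  "concl_1_4 g c I \<longleftrightarrow>
      (\<exists>(V::(nat \<Rightarrow> 'f) set) ip X Y. hilbert_space c V ip
          \<and> (\<forall>j<g. bounded_op V ip (X j) \<and> is_adjoint V ip (X j) (Y j))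
          \<and> (\<forall>p\<in>polys g. (\<forall>u\<in>V. op_eval p X Y u = (\<lambda>n. 0)) \<longleftrightarrow> p \<in> I))
      \<and> hard_rad g c I = I"

end

theory Submission
  imports Defs "HOL-Analysis.Convex" "HOL-Computational_Algebra.Polynomial" "HOL-Library.Nat_Bijection"
begin

text \<open>
  Since \<open>I\<close> is graded, left multiplication on the finite-dimensional quotient of the free algebra by
  \<open>I\<close> and all words of length more than \<open>N\<close> gives matrices \<open>A\<^sub>j\<close>, \<open>B\<^sub>j\<close> (for \<open>x\<^sub>j\<close> and \<open>x\<^sub>j\<^sup>*\<close>) that
  satisfy exactly the relations of \<open>I\<close> in degree at most \<open>N\<close>, but \<open>B\<^sub>j\<close> is not the adjoint of \<open>A\<^sub>j\<close>.
  The direct sums \<open>A\<^sub>j \<oplus> B\<^sub>j\<^sup>*\<close> and \<open>B\<^sub>j \<oplus> A\<^sub>j\<^sup>*\<close> are adjoint with respect to the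
  indefinite form that swaps the two summands. Joining this form to definite ones by a one-parameter
  family keeps the analytic relations and their adjoints valid, because they only involve one
  of the two families of operators. The value of any other polynomial is a Laurent polynomial in the
  parameter, so if it is nonzero for the swap form, then it is nonzero for all but finitely many of the
  definite forms. A Hilbert space direct sum over \<open>N\<close> and infinitely many parameters, scaled
  to norm at most one, then detects all of \<open>I\<close>.
\<close>

section \<open>Noncommutative polynomials and star ideals\<close>

text \<open>Reweighting of the homogeneous components. An indicator weight cuts out degrees, and the
  weight \<open>a ^ d\<close> in degree \<open>d\<close> is the substitution of \<open>a\<close>
  times each letter for that letter. Stability under all weights is the form in which an ideal is
  shown to be graded.\<close>

definition wt :: "(nat \<Rightarrow> 'f) \<Rightarrow> (ltr list \<Rightarrow> 'f::real_normed_field) \<Rightarrow> ltr list \<Rightarrow> 'f" where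
  "wt \<phi> p = (\<lambda>w. \<phi> (length w) * p w)"

definition single :: "ltr list \<Rightarrow> ltr list \<Rightarrow> 'f::real_normed_field" where
  "single u = (\<lambda>w. if w = u then 1 else 0)"

lemma polys_finite: "p \<in> polys g \<Longrightarrow> finite {w. p w \<noteq> 0}"
  by (simp add: polys_def)

lemma polys_lidx: "p \<in> polys g \<Longrightarrow> p w \<noteq> 0 \<Longrightarrow> l \<in> set w \<Longrightarrow> lidx l < g"
  by (auto simp: polys_def)

lemma polys_subI:
  assumes "p \<in> polys g" "\<And>w. p w = 0 \<Longrightarrow> q w = 0"
  shows "q \<in> polys g"
proof -
  have "{w. q w \<noteq> 0} \<subseteq> {w. p w \<noteq> 0}" using assms(2) by auto
  then show ?thesis using assms by (auto simp: polys_def intro: finite_subset)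
qed

lemma zero_polys: "(\<lambda>w. 0) \<in> polys g"
  by (simp add: polys_def)

lemma single_polys: "(\<And>l. l \<in> set w \<Longrightarrow> lidx l < g) \<Longrightarrow> single w \<in> polys g"
  by (auto simp: polys_def single_def)

lemma wt_polys: "p \<in> polys g \<Longrightarrow> wt \<phi> p \<in> polys g"
  by (erule polys_subI) (simp add: wt_def)

lemma padd_polys:
  assumes "p \<in> polys g" "q \<in> polys g"
  shows "padd p q \<in> polys g"
proof -
  have "{w. padd p q w \<noteq> 0} \<subseteq> {w. p w \<noteq> 0} \<union> {w. q w \<noteq> 0}" by (auto simp: padd_def)
  moreover have "finite ({w. p w \<noteq> 0} \<union> {w. q w \<noteq> 0})" using assms by (simp add: polys_finite)
  ultimately show ?thesis using assms by (auto simp: polys_def intro: finite_subset)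
qed

text \<open>Cutting a word at a position is the same as writing it as a concatenation of two words.
  In the new form the index set no longer depends on \<open>w\<close>, so the sum can be
  interchanged with one over \<open>w\<close>.\<close>

lemma pmult_eq_sum:
  assumes "finite {w. p w \<noteq> 0}" "finite {w. q w \<noteq> 0}"
  shows "pmult p q w = (\<Sum>x\<in>{w. p w \<noteq> 0} \<times> {w. q w \<noteq> 0}.
           if fst x @ snd x = w then p (fst x) * q (snd x) else 0)" (is "_ = sum ?f ?A")
proof -
  let ?h = "\<lambda>k. (take k w, drop k w)"
  have inj: "inj_on ?h {..length w}"
    by (rule inj_onI) (metis atMost_iff length_take min.absorb2 prod.inject)
  have T: "?h ` {..length w} = {x. fst x @ snd x = w}"
  proof (intro set_eqI iffI)
    fix x assume "x \<in> {x. fst x @ snd x = w}"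
    then have "x = ?h (length (fst x))" "length (fst x) \<le> length w" by auto
    then show "x \<in> ?h ` {..length w}" by blast
  qed auto
  have fT: "finite {x. fst x @ snd x = w}" unfolding T[symmetric] by simp
  have "pmult p q w = (\<Sum>x\<in>{x. fst x @ snd x = w}. p (fst x) * q (snd x))"
    unfolding T[symmetric] by (simp add: sum.reindex[OF inj] pmult_def)
  also have "\<dots> = (\<Sum>x\<in>{x. fst x @ snd x = w} \<inter> ?A. p (fst x) * q (snd x))"
    by (rule sum.mono_neutral_right) (use fT in auto)
  also have "\<dots> = sum ?f ?A"
    by (rule sum.mono_neutral_cong_left) (use assms in auto)
  finally show ?thesis .
qed

lemma pmult_support:
  assumes "finite {w. p w \<noteq> 0}" "finite {w. q w \<noteq> 0}"
  shows "{w. pmult p q w \<noteq> 0} \<subseteq> (\<lambda>x. fst x @ snd x) ` ({w. p w \<noteq> 0} \<times> {w. q w \<noteq> 0})"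
proof
  fix w assume "w \<in> {w. pmult p q w \<noteq> 0}"
  then have "pmult p q w \<noteq> 0" by simp
  then obtain x where "x \<in> {w. p w \<noteq> 0} \<times> {w. q w \<noteq> 0}"
      "(if fst x @ snd x = w then p (fst x) * q (snd x) else 0) \<noteq> 0"
    unfolding pmult_eq_sum[OF assms] by (rule sum.not_neutral_contains_not_neutral)
  then show "w \<in> (\<lambda>x. fst x @ snd x) ` ({w. p w \<noteq> 0} \<times> {w. q w \<noteq> 0})"
    by (auto split: if_splits)
qed

text \<open>\<open>F\<close> stands for any quantity attached to words, later a coordinate of a word
  evaluated at matrices; this makes evaluation multiplicative. Several pairs may concatenate to the
  same word, hence the double sum over the image \<open>?R\<close> and the pairs.\<close>

lemma sum_pmult:
  assumes fp: "finite {w. p w \<noteq> 0}" and fq: "finite {w. q w \<noteq> 0}"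
  shows "(\<Sum>w | pmult p q w \<noteq> 0. pmult p q w * F w)
       = (\<Sum>u | p u \<noteq> 0. \<Sum>v | q v \<noteq> 0. p u * q v * F (u @ v))"
proof -
  let ?A = "{w. p w \<noteq> 0} \<times> {w. q w \<noteq> 0}"
  let ?R = "(\<lambda>x. fst x @ snd x) ` ?A"
  have fA: "finite ?A" using fp fq by blast
  have "(\<Sum>w | pmult p q w \<noteq> 0. pmult p q w * F w) = (\<Sum>w\<in>?R. pmult p q w * F w)"
    by (rule sum.mono_neutral_left) (use fA pmult_support[OF fp fq] in auto)
  also have "\<dots> = (\<Sum>w\<in>?R. \<Sum>x\<in>?A. if fst x @ snd x = w
                      then p (fst x) * q (snd x) * F (fst x @ snd x) else 0)"
    unfolding pmult_eq_sum[OF fp fq] sum_distrib_right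
    by (intro sum.cong refl) auto
  also have "\<dots> = (\<Sum>x\<in>?A. \<Sum>w\<in>?R. if fst x @ snd x = w
                      then p (fst x) * q (snd x) * F (fst x @ snd x) else 0)"
    by (rule sum.swap)
  also have "\<dots> = (\<Sum>x\<in>?A. p (fst x) * q (snd x) * F (fst x @ snd x))"
    by (intro sum.cong refl, subst sum.delta') (use fA in auto)
  also have "\<dots> = (\<Sum>u | p u \<noteq> 0. \<Sum>v | q v \<noteq> 0. p u * q v * F (u @ v))"
    by (simp add: sum.cartesian_product case_prod_unfold)
  finally show ?thesis .
qed

lemma pmult_polys:
  assumes "p \<in> polys g" "q \<in> polys g"
  shows "pmult p q \<in> polys g"
proof -
  note f = polys_finite[OF assms(1)] polys_finite[OF assms(2)]
  have "finite {w. pmult p q w \<noteq> 0}"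
    by (rule finite_subset[OF pmult_support[OF f]]) (use f in auto)
  moreover have "lidx l < g" if "pmult p q w \<noteq> 0" "l \<in> set w" for w l
  proof -
    have "w \<in> (\<lambda>x. fst x @ snd x) ` ({w. p w \<noteq> 0} \<times> {w. q w \<noteq> 0})"
      using that(1) pmult_support[OF f] by blast
    then show ?thesis using that(2) polys_lidx[OF assms(1)] polys_lidx[OF assms(2)] by auto
  qed
  ultimately show ?thesis by (auto simp: polys_def)
qed

lemma lstar_lstar [simp]: "lstar (lstar l) = l"
  by (cases l) auto

lemma lidx_lstar [simp]: "lidx (lstar l) = lidx l"
  by (cases l) auto

lemma wstar_wstar [simp]: "wstar (wstar w) = w"
  by (simp add: wstar_def rev_map comp_def)

lemma length_wstar [simp]: "length (wstar w) = length w"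
  by (simp add: wstar_def)

lemma wstar_Cons: "wstar (l # w) = wstar w @ [lstar l]"
  by (simp add: wstar_def)

lemma pmult_single_Nil [simp]: "pmult p (single []) = p"
proof
  fix w
  have "pmult p (single []) w = (\<Sum>k\<le>length w. if k = length w then p w else 0)"
    unfolding pmult_def by (intro sum.cong refl) (auto simp: single_def)
  then show "pmult p (single []) w = p w" by simp
qed

lemma single_Nil_pmult [simp]: "pmult (single []) p = p"
proof
  fix w
  have "pmult (single []) p w = (\<Sum>k\<le>length w. if k = 0 then p w else 0)"
    unfolding pmult_def by (intro sum.cong refl) (auto simp: single_def)
  then show "pmult (single []) p w = p w" by simp
qed

lemma pmult_const: "pmult (\<lambda>w. if w = [] then a else 0) p = (\<lambda>w. a * p w)"
proof
  fix w
  have "pmult (\<lambda>w. if w = [] then a else 0) p w = (\<Sum>k\<le>length w. if k = 0 then a * p w else 0)"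
    unfolding pmult_def by (intro sum.cong refl) auto
  then show "pmult (\<lambda>w. if w = [] then a else 0) p w = a * p w" by simp
qed

text \<open>One-sided multiplication is the two-sided closure with the unit \<open>single []\<close>
  on the other side; scalar multiples are products with a constant polynomial.\<close>

lemma star_idealD:
  assumes "star_ideal g c I"
  shows "I \<subseteq> polys g" "(\<lambda>w. 0) \<in> I" "\<And>p q. p \<in> I \<Longrightarrow> q \<in> I \<Longrightarrow> padd p q \<in> I"
    "\<And>p. p \<in> I \<Longrightarrow> pstar c p \<in> I"
    "\<And>a p. p \<in> I \<Longrightarrow> a \<in> polys g \<Longrightarrow> pmult a p \<in> I"
    "\<And>b p. p \<in> I \<Longrightarrow> b \<in> polys g \<Longrightarrow> pmult p b \<in> I"
    "\<And>a p. p \<in> I \<Longrightarrow> (\<lambda>w. a * p w) \<in> I"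
proof -
  show "I \<subseteq> polys g" "(\<lambda>w. 0) \<in> I" "\<And>p q. p \<in> I \<Longrightarrow> q \<in> I \<Longrightarrow> padd p q \<in> I"
    "\<And>p. p \<in> I \<Longrightarrow> pstar c p \<in> I"
    using assms by (auto simp: star_ideal_def)
  have m: "pmult a (pmult p b) \<in> I" if "p \<in> I" "a \<in> polys g" "b \<in> polys g" for a p b
    using assms that by (auto simp: star_ideal_def)
  have s: "single [] \<in> polys g" by (rule single_polys) simp
  show l: "pmult a p \<in> I" if "p \<in> I" "a \<in> polys g" for a p
    using m[OF that s] by simp
  show "pmult p b \<in> I" if "p \<in> I" "b \<in> polys g" for p b
    using m[OF that(1) s that(2)] by simp
  show "(\<lambda>w. a * p w) \<in> I" if "p \<in> I" for a p
    using l[OF that, of "\<lambda>w. if w = [] then a else 0"] by (simp add: pmult_const polys_def)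
qed

lemma star_ideal_sum:
  assumes "star_ideal g c I" "\<And>k. k \<in> K \<Longrightarrow> f k \<in> I"
  shows "(\<lambda>w. \<Sum>k\<in>K. f k w) \<in> I"
  using assms(2)
proof (induction K rule: infinite_finite_induct)
  case (insert x F)
  then have "padd (f x) (\<lambda>w. \<Sum>k\<in>F. f k w) \<in> I"
    by (intro star_idealD(3)[OF assms(1)]) auto
  then show ?case using insert by (simp add: padd_def)
qed (use star_idealD(2)[OF assms(1)] in auto)

lemma star_ideal_diff:
  assumes "star_ideal g c I" "p \<in> I" "q \<in> I"
  shows "(\<lambda>w. p w - q w) \<in> I"
  using star_idealD(3)[OF assms(1,2) star_idealD(7)[OF assms(1,3), of "-1"]] by (simp add: padd_def)

section \<open>The scalar field with its conjugation, and ideals over it\<close>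

text \<open>Treats the reals with \<open>id\<close> and the complex numbers with \<open>cnj\<close>
  at once. \<open>mult_c\<close> makes the form with summands \<open>u i * c (v i)\<close> positive
  definite; completeness of the field serves the convergence of series and of Cauchy
  sequences.\<close>

locale conj_field =
  fixes c :: "'f::{real_normed_field,banach} \<Rightarrow> 'f"
  assumes c_add: "c (x + y) = c x + c y"
    and c_mult: "c (x * y) = c x * c y"
    and c_c [simp]: "c (c x) = x"
    and mult_c: "x * c x = of_real ((norm x)\<^sup>2)"
begin

lemma c_0 [simp]: "c 0 = 0"
  using c_add[of 0 0] by simp

lemma c_eq_0 [simp]: "c x = 0 \<longleftrightarrow> x = 0"
  by (metis c_0 c_c)

lemma c_1 [simp]: "c 1 = 1"
  using mult_c[of 1] by simp

lemma c_minus: "c (- x) = - c x"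
  by (metis add_eq_0_iff c_0 c_add)

lemma c_diff: "c (x - y) = c x - c y"
  by (metis c_add c_minus diff_conv_add_uminus)

lemma c_sum: "c (sum f A) = (\<Sum>x\<in>A. c (f x))"
  by (induction A rule: infinite_finite_induct) (auto simp: c_add)

lemma norm_c [simp]: "norm (c x) = norm x"
proof (cases "x = 0")
  case False
  have "norm x * norm (c x) = norm x * norm x"
    by (metis abs_of_nonneg mult_c norm_mult norm_of_real power2_eq_square zero_le_power2)
  then show ?thesis using False by simp
qed simp

lemma c_divide: "c (x / y) = c x / c y"
  by (cases "y = 0") (auto simp: field_simps simp flip: c_mult)

lemma c_of_nat [simp]: "c (of_nat k) = of_nat k"
  by (induction k) (auto simp: c_add)

lemma c_numeral [simp]: "c (numeral k) = numeral k"
  using c_of_nat[of "numeral k"] by simp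

text \<open>A nonnegative real is \<open>x * c x\<close> for its square root \<open>x\<close>, and
  \<open>c\<close> merely swaps the two factors. Negative reals follow by additivity.\<close>

lemma c_of_real [simp]: "c (of_real r) = of_real r"
proof -
  have pos: "c (of_real r) = of_real r" if "r \<ge> 0" for r
  proof -
    let ?x = "of_real (sqrt r)"
    have "?x * c ?x = of_real r" using mult_c[of ?x] that by simp
    then show ?thesis by (metis c_c c_mult mult.commute)
  qed
  show ?thesis using pos[of r] pos[of "-r"] by (cases "r \<ge> 0") (auto simp: c_minus)
qed

lemma pstar_polys:
  assumes "p \<in> polys g"
  shows "pstar c p \<in> polys g"
proof -
  have "{w. pstar c p w \<noteq> 0} = wstar ` {w. p w \<noteq> 0}"
    by (auto simp: pstar_def image_iff) (metis wstar_wstar)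
  then have "finite {w. pstar c p w \<noteq> 0}" using polys_finite[OF assms] by simp
  moreover have "lidx l < g" if "pstar c p w \<noteq> 0" "l \<in> set w" for w l
  proof -
    have "lstar l \<in> set (wstar w)" using that(2) by (auto simp: wstar_def)
    then show ?thesis using that(1) polys_lidx[OF assms, of "wstar w" "lstar l"] by (simp add: pstar_def)
  qed
  ultimately show ?thesis by (auto simp: polys_def)
qed

lemma pstar_pstar [simp]: "pstar c (pstar c p) = p"
  by (simp add: pstar_def)

lemma star_ideal_polys: "star_ideal g c (polys g)"
  by (auto simp: star_ideal_def zero_polys padd_polys pmult_polys pstar_polys)

lemma star_ideal_gen_star_ideal:
  assumes "S \<subseteq> polys g"
  shows "star_ideal g c (star_ideal_gen g c S)"
proof -
  have "star_ideal_gen g c S \<subseteq> polys g"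
    using assms star_ideal_polys by (auto simp: star_ideal_gen_def)
  then show ?thesis unfolding star_ideal_def
    by (auto simp: star_ideal_gen_def star_ideal_def)
qed

lemma star_ideal_gen_least:
  "star_ideal g c J \<Longrightarrow> S \<subseteq> J \<Longrightarrow> star_ideal_gen g c S \<subseteq> J"
  by (auto simp: star_ideal_gen_def)

lemma star_ideal_gen_superset: "S \<subseteq> star_ideal_gen g c S"
  by (auto simp: star_ideal_gen_def)

section \<open>Homogeneous generators give a graded ideal\<close>

text \<open>Split \<open>a\<close> into homogeneous components. Against the component of degree
  \<open>d\<close>, a weight on the product is the weight shifted by \<open>d\<close> on
  \<open>q\<close>, which is why the hypothesis on \<open>q\<close> ranges over all weights.\<close>

lemma wt_pmult_left:
  assumes I: "star_ideal g c I" and a: "a \<in> polys g" and q: "\<And>\<phi>. wt \<phi> q \<in> I"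
  shows "wt \<phi> (pmult a q) \<in> I"
proof -
  obtain D where D: "\<And>w. a w \<noteq> 0 \<Longrightarrow> length w \<le> D"
    using finite_nat_set_iff_bounded_le[of "length ` {w. a w \<noteq> 0}"] polys_finite[OF a] by auto
  let ?f = "\<lambda>d. pmult (wt (\<lambda>n. if n = d then 1 else 0) a) (wt (\<lambda>n. \<phi> (d + n)) q)"
  have "wt \<phi> (pmult a q) = (\<lambda>w. \<Sum>d\<le>D. ?f d w)"
  proof
    fix w
    have "(\<Sum>d\<le>D. ?f d w) = (\<Sum>d\<le>D. \<Sum>k\<le>length w. if d = k then \<phi> (length w) * (a (take k w) * q (drop k w)) else 0)"
      unfolding pmult_def wt_def by (intro sum.cong refl) auto
    also have "\<dots> = (\<Sum>k\<le>length w. \<Sum>d\<le>D. if d = k then \<phi> (length w) * (a (take k w) * q (drop k w)) else 0)"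
      by (rule sum.swap)
    also have "\<dots> = (\<Sum>k\<le>length w. \<phi> (length w) * (a (take k w) * q (drop k w)))"
    proof (intro sum.cong refl)
      fix k assume "k \<in> {..length w}"
      then have "length (take k w) = k" by simp
      then have "a (take k w) = 0" if "\<not> k \<le> D" using D[of "take k w"] that by auto
      then show "(\<Sum>d\<le>D. if d = k then \<phi> (length w) * (a (take k w) * q (drop k w)) else 0)
        = \<phi> (length w) * (a (take k w) * q (drop k w))" by (auto simp: sum.delta)
    qed
    also have "\<dots> = wt \<phi> (pmult a q) w" by (simp add: wt_def pmult_def sum_distrib_left)
    finally show "wt \<phi> (pmult a q) w = (\<Sum>d\<le>D. ?f d w)" by simp
  qed
  moreover have "?f d \<in> I" for d
    by (intro star_idealD(5)[OF I] q wt_polys a)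
  ultimately show ?thesis using star_ideal_sum[OF I, of "{..D}" ?f] by simp
qed

lemma wt_pmult_right:
  assumes I: "star_ideal g c I" and a: "a \<in> polys g" and q: "\<And>\<phi>. wt \<phi> q \<in> I"
  shows "wt \<phi> (pmult q a) \<in> I"
proof -
  obtain D where D: "\<And>w. a w \<noteq> 0 \<Longrightarrow> length w \<le> D"
    using finite_nat_set_iff_bounded_le[of "length ` {w. a w \<noteq> 0}"] polys_finite[OF a] by auto
  let ?f = "\<lambda>d. pmult (wt (\<lambda>n. \<phi> (n + d)) q) (wt (\<lambda>n. if n = d then 1 else 0) a)"
  have "wt \<phi> (pmult q a) = (\<lambda>w. \<Sum>d\<le>D. ?f d w)"
  proof
    fix w
    have "(\<Sum>d\<le>D. ?f d w) = (\<Sum>d\<le>D. \<Sum>k\<le>length w. if d = length w - k then \<phi> (length w) * (q (take k w) * a (drop k w)) else 0)"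
      unfolding pmult_def wt_def by (intro sum.cong refl) auto
    also have "\<dots> = (\<Sum>k\<le>length w. \<Sum>d\<le>D. if d = length w - k then \<phi> (length w) * (q (take k w) * a (drop k w)) else 0)"
      by (rule sum.swap)
    also have "\<dots> = (\<Sum>k\<le>length w. \<phi> (length w) * (q (take k w) * a (drop k w)))"
    proof (intro sum.cong refl)
      fix k
      have "a (drop k w) = 0" if "\<not> length w - k \<le> D" using D[of "drop k w"] that by auto
      then show "(\<Sum>d\<le>D. if d = length w - k then \<phi> (length w) * (q (take k w) * a (drop k w)) else 0)
        = \<phi> (length w) * (q (take k w) * a (drop k w))" by (auto simp: sum.delta)
    qed
    also have "\<dots> = wt \<phi> (pmult q a) w" by (simp add: wt_def pmult_def sum_distrib_left)
    finally show "wt \<phi> (pmult q a) w = (\<Sum>d\<le>D. ?f d w)" by simp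
  qed
  moreover have "?f d \<in> I" for d
    by (intro star_idealD(6)[OF I] q wt_polys a)
  ultimately show ?thesis using star_ideal_sum[OF I, of "{..D}" ?f] by simp
qed

text \<open>The elements of the ideal all of whose reweightings stay in it form a star ideal. A
  homogeneous generator is only multiplied by a scalar under reweighting, so this smaller ideal
  contains the generators and is everything.\<close>

lemma wt_star_ideal_gen:
  assumes S: "S \<subseteq> polys g" "\<And>s. s \<in> S \<Longrightarrow> homogeneous s"
    and p: "p \<in> star_ideal_gen g c S"
  shows "wt \<phi> p \<in> star_ideal_gen g c S"
proof -
  define I where "I = star_ideal_gen g c S"
  have I: "star_ideal g c I" unfolding I_def by (rule star_ideal_gen_star_ideal[OF S(1)])
  let ?J = "{q \<in> I. \<forall>\<phi>. wt \<phi> q \<in> I}"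
  have "star_ideal g c ?J"
    unfolding star_ideal_def
  proof (intro conjI ballI)
    show "?J \<subseteq> polys g" using star_idealD(1)[OF I] by auto
    show "(\<lambda>w. 0) \<in> ?J" using star_idealD(2)[OF I] by (simp add: wt_def)
    fix q assume q: "q \<in> ?J"
    show "pstar c q \<in> ?J"
    proof -
      have "wt \<phi> (pstar c q) = pstar c (wt (\<lambda>n. c (\<phi> n)) q)" for \<phi>
        by (simp add: wt_def pstar_def c_mult)
      then show ?thesis using q star_idealD(4)[OF I] by auto
    qed
    fix q' assume "q' \<in> ?J"
    moreover have "wt \<phi> (padd q q') = padd (wt \<phi> q) (wt \<phi> q')" for \<phi>
      by (simp add: wt_def padd_def algebra_simps)
    ultimately show "padd q q' \<in> ?J" using q star_idealD(3)[OF I] by auto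
  next
    fix q a b :: "ltr list \<Rightarrow> 'f" assume q: "q \<in> ?J" and ab: "a \<in> polys g" "b \<in> polys g"
    have "wt \<phi> (pmult q b) \<in> I" for \<phi>
      by (rule wt_pmult_right[OF I ab(2)]) (use q in auto)
    then have "wt \<phi> (pmult a (pmult q b)) \<in> I" for \<phi>
      by (rule wt_pmult_left[OF I ab(1)])
    then show "pmult a (pmult q b) \<in> ?J"
      using q ab star_idealD(5,6)[OF I] by auto
  qed
  moreover have "S \<subseteq> ?J"
  proof
    fix s assume s: "s \<in> S"
    then obtain d where d: "\<And>w. s w \<noteq> 0 \<Longrightarrow> length w = d"
      using S(2)[of s] by (auto simp: homogeneous_def)
    have sI: "s \<in> I" using s star_ideal_gen_superset by (auto simp: I_def)
    have "wt \<phi> s = (\<lambda>w. \<phi> d * s w)" for \<phi> using d by (fastforce simp: wt_def)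
    then show "s \<in> ?J" using sI star_idealD(7)[OF I] by auto
  qed
  ultimately have "I \<subseteq> ?J" unfolding I_def by (rule star_ideal_gen_least)
  then show ?thesis using p by (auto simp: I_def)
qed

end

section \<open>Evaluation at matrices\<close>

definition mv :: "nat \<Rightarrow> (nat \<Rightarrow> nat \<Rightarrow> 'f::real_normed_field) \<Rightarrow> (nat \<Rightarrow> 'f) \<Rightarrow> nat \<Rightarrow> 'f" where
  "mv n A u = (\<lambda>i. \<Sum>k<n. A i k * u k)"

text \<open>Letters receive arbitrary matrices, so \<open>M (Ls j)\<close> may differ from the
  adjoint of \<open>M (Lx j)\<close>. The genuine evaluations are those at
  \<open>mletters c X\<close>. A vector is a function of which only the first \<open>n\<close>
  entries matter.\<close>

fun vw :: "nat \<Rightarrow> (ltr \<Rightarrow> nat \<Rightarrow> nat \<Rightarrow> 'f::real_normed_field) \<Rightarrow> ltr list \<Rightarrow> (nat \<Rightarrow> 'f) \<Rightarrow> nat \<Rightarrow> 'f" where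
  "vw n M [] u = u"
| "vw n M (l # w) u = mv n (M l) (vw n M w u)"

definition vev :: "nat \<Rightarrow> (ltr \<Rightarrow> nat \<Rightarrow> nat \<Rightarrow> 'f::real_normed_field) \<Rightarrow> (ltr list \<Rightarrow> 'f)
    \<Rightarrow> (nat \<Rightarrow> 'f) \<Rightarrow> nat \<Rightarrow> 'f" where
  "vev n M p u = (\<lambda>i. \<Sum>w | p w \<noteq> 0. p w * vw n M w u i)"

definition kills :: "nat \<Rightarrow> (ltr \<Rightarrow> nat \<Rightarrow> nat \<Rightarrow> 'f::real_normed_field) \<Rightarrow> (ltr list \<Rightarrow> 'f) \<Rightarrow> bool" where
  "kills n M p \<longleftrightarrow> (\<forall>u. \<forall>i<n. vev n M p u i = 0)"

definition mletters :: "('f \<Rightarrow> 'f) \<Rightarrow> (nat \<Rightarrow> nat \<Rightarrow> nat \<Rightarrow> 'f::real_normed_field) \<Rightarrow> ltr \<Rightarrow> nat \<Rightarrow> nat \<Rightarrow> 'f" where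
  "mletters c X l = (case l of Lx j \<Rightarrow> X j | Ls j \<Rightarrow> madj c (X j))"

lemma mletters_simps: "mletters c X (Lx j) = X j" "mletters c X (Ls j) = madj c (X j)"
  by (simp_all add: mletters_def)

lemma vev_superset:
  assumes "finite W" "{w. p w \<noteq> 0} \<subseteq> W"
  shows "vev n M p u i = (\<Sum>w\<in>W. p w * vw n M w u i)"
  unfolding vev_def by (rule sum.mono_neutral_left) (use assms in auto)

lemma mv_cong: "(\<And>k. k < n \<Longrightarrow> u k = v k) \<Longrightarrow> mv n A u = mv n A v"
  by (auto simp: mv_def intro!: ext sum.cong)

lemma vw_cong: "(\<And>k. k < n \<Longrightarrow> u k = v k) \<Longrightarrow> i < n \<Longrightarrow> vw n M w u i = vw n M w v i"
proof (induction w arbitrary: i)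
  case (Cons l w)
  then show ?case by (simp add: mv_cong[of n "vw n M w u" "vw n M w v"])
qed simp

lemma vw_append: "vw n M (v @ w) u = vw n M v (vw n M w u)"
  by (induction v) auto

lemma mv_sum: "mv n A (\<lambda>i. \<Sum>k\<in>K. a k * f k i) = (\<lambda>i. \<Sum>k\<in>K. a k * mv n A (f k) i)"
proof
  fix i
  have "mv n A (\<lambda>i. \<Sum>k\<in>K. a k * f k i) i = (\<Sum>j<n. \<Sum>k\<in>K. a k * (A i j * f k j))"
    by (simp add: mv_def sum_distrib_left mult_ac)
  also have "\<dots> = (\<Sum>k\<in>K. \<Sum>j<n. a k * (A i j * f k j))" by (rule sum.swap)
  finally show "mv n A (\<lambda>i. \<Sum>k\<in>K. a k * f k i) i = (\<Sum>k\<in>K. a k * mv n A (f k) i)"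
    by (simp add: mv_def sum_distrib_left)
qed

lemma vw_sum: "vw n M w (\<lambda>i. \<Sum>k\<in>K. a k * f k i) = (\<lambda>i. \<Sum>k\<in>K. a k * vw n M w (f k) i)"
  by (induction w) (auto simp: mv_sum)

lemma vev_sum: "vev n M p (\<lambda>i. \<Sum>k\<in>K. a k * f k i) = (\<lambda>i. \<Sum>k\<in>K. a k * vev n M p (f k) i)"
proof
  fix i
  have "vev n M p (\<lambda>i. \<Sum>k\<in>K. a k * f k i) i = (\<Sum>w | p w \<noteq> 0. \<Sum>k\<in>K. a k * (p w * vw n M w (f k) i))"
    by (simp add: vev_def vw_sum sum_distrib_left mult_ac)
  also have "\<dots> = (\<Sum>k\<in>K. \<Sum>w | p w \<noteq> 0. a k * (p w * vw n M w (f k) i))" by (rule sum.swap)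
  finally show "vev n M p (\<lambda>i. \<Sum>k\<in>K. a k * f k i) i = (\<Sum>k\<in>K. a k * vev n M p (f k) i)"
    by (simp add: vev_def sum_distrib_left)
qed

lemma vev_cong: "(\<And>k. k < n \<Longrightarrow> u k = v k) \<Longrightarrow> i < n \<Longrightarrow> vev n M p u i = vev n M p v i"
  unfolding vev_def by (intro sum.cong refl arg_cong2[where f="(*)"] vw_cong) auto

lemma kills_basis:
  assumes "\<And>i j. i < n \<Longrightarrow> j < n \<Longrightarrow> vev n M p (\<lambda>i. if i = j then 1 else 0) i = 0"
  shows "kills n M p"
  unfolding kills_def
proof (intro allI impI)
  fix u :: "nat \<Rightarrow> 'a" and i assume i: "i < n"
  have "vev n M p u i = vev n M p (\<lambda>i. \<Sum>j<n. u j * (if i = j then 1 else 0)) i"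
    by (rule vev_cong[OF _ i]) (simp add: if_distrib sum.delta' cong: if_cong)
  also have "\<dots> = 0" by (subst vev_sum) (simp add: assms i)
  finally show "vev n M p u i = 0" .
qed

text \<open>Column \<open>j\<close> of a matrix is its value at the \<open>j\<close>-th unit vector;
  this translates matrix products into iterated application to vectors.\<close>

lemma mat_word_eq: "mat_word n c X w i j = vw n (mletters c X) w (\<lambda>i. if i = j then 1 else 0) i"
proof (induction w arbitrary: i)
  case (Cons l w)
  then show ?case by (cases l) (simp_all add: mv_def mmult_def mletters_def)
qed simp

lemma mat_zero_iff: "mat_zero n (mat_eval n c p X) \<longleftrightarrow> kills n (mletters c X) p"
proof
  assume "mat_zero n (mat_eval n c p X)"
  then show "kills n (mletters c X) p"
    by (intro kills_basis) (simp add: mat_zero_def mat_eval_def vev_def mat_word_eq)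
next
  assume "kills n (mletters c X) p"
  then show "mat_zero n (mat_eval n c p X)"
    by (simp add: mat_zero_def mat_eval_def kills_def vev_def mat_word_eq)
qed

lemma vev_pmult:
  assumes "finite {w. p w \<noteq> 0}" "finite {w. q w \<noteq> 0}"
  shows "vev n M (pmult p q) u i = vev n M p (vev n M q u) i"
proof -
  have "vev n M (pmult p q) u i = (\<Sum>v | p v \<noteq> 0. \<Sum>w | q w \<noteq> 0. p v * q w * vw n M (v @ w) u i)"
    unfolding vev_def by (rule sum_pmult[OF assms])
  also have "\<dots> = vev n M p (vev n M q u) i"
    by (simp add: vev_def vw_append vw_sum sum_distrib_left mult_ac)
  finally show ?thesis .
qed

lemma vev_zero_vec: "(\<And>k. k < n \<Longrightarrow> u k = 0) \<Longrightarrow> i < n \<Longrightarrow> vev n M p u i = 0"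
  using vev_cong[of n u "\<lambda>_. 0" i M p] vev_sum[of n M p "\<lambda>_. 0" "\<lambda>_ _. 0" "{}"] by simp

lemma kills_padd:
  assumes "p \<in> polys g" "q \<in> polys g" "kills n M p" "kills n M q"
  shows "kills n M (padd p q)"
  unfolding kills_def
proof (intro allI impI)
  fix u i assume i: "i < n"
  let ?W = "{w. p w \<noteq> 0} \<union> {w. q w \<noteq> 0}"
  have f: "finite ?W" using assms by (simp add: polys_finite)
  have "vev n M (padd p q) u i = (\<Sum>w\<in>?W. padd p q w * vw n M w u i)"
    by (rule vev_superset[OF f]) (auto simp: padd_def)
  also have "\<dots> = vev n M p u i + vev n M q u i"
    by (subst (1 2) vev_superset[OF f]) (auto simp: padd_def algebra_simps sum.distrib)
  finally show "vev n M (padd p q) u i = 0" using assms i by (simp add: kills_def)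
qed

text \<open>The interesting instances are \<open>u \<mapsto> f + t h\<close> for a vector \<open>u = (f, h)\<close> consisting of two
  blocks of length \<open>m\<close>, and diagonal scalings.\<close>

lemma vev_intertwine:
  fixes \<alpha> \<beta> :: "nat \<Rightarrow> 'f::real_normed_field" and m :: nat
  defines "\<Phi> \<equiv> \<lambda>u i. \<alpha> i * u i + \<beta> i * u (m + i)"
  assumes letter: "\<And>l u i. P l \<Longrightarrow> i < n' \<Longrightarrow> \<Phi> (mv n (M l) u) i = mv n' (M' l) (\<Phi> u) i"
    and p: "\<And>w l. p w \<noteq> 0 \<Longrightarrow> l \<in> set w \<Longrightarrow> P l" and i: "i < n'"
  shows "\<Phi> (vev n M p u) i = vev n' M' p (\<Phi> u) i"
proof -
  have word: "\<Phi> (vw n M w u) i = vw n' M' w (\<Phi> u) i" if "\<forall>l\<in>set w. P l" "i < n'" for w i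
    using that
  proof (induction w arbitrary: i)
    case (Cons l w)
    then have "\<Phi> (vw n M (l # w) u) i = mv n' (M' l) (\<Phi> (vw n M w u)) i" by (simp add: letter)
    also have "\<dots> = mv n' (M' l) (vw n' M' w (\<Phi> u)) i"
      by (subst mv_cong) (use Cons in auto)
    finally show ?case by simp
  qed simp
  have "\<Phi> (vev n M p u) i = (\<Sum>w | p w \<noteq> 0. p w * \<Phi> (vw n M w u) i)"
    by (simp add: \<Phi>_def vev_def sum_distrib_left sum.distrib algebra_simps)
  also have "\<dots> = vev n' M' p (\<Phi> u) i"
    unfolding vev_def by (intro sum.cong refl) (use p i in \<open>auto simp: word\<close>)
  finally show ?thesis .
qed

lemma vw_scale: "vw n (\<lambda>l i k. a * M l i k) w u = (\<lambda>i. a ^ length w * vw n M w u i)"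
  by (induction w) (simp_all add: mv_def sum_distrib_left mult_ac)

text \<open>A nonzero \<open>a\<close> leaves the support of the polynomial unchanged, so both sums
  run over the same words. This is how matrices are made small without losing the relations of a
  graded ideal.\<close>

lemma vev_scale:
  assumes "a \<noteq> 0"
  shows "vev n (\<lambda>l i k. a * M l i k) p u = vev n M (wt (\<lambda>d. a ^ d) p) u"
  using assms by (simp add: vev_def vw_scale wt_def mult_ac)

section \<open>Adjoints of evaluations\<close>

context conj_field
begin

text \<open>The assignment at which the starred polynomial takes the adjoint value:
  \<open>pstar c p\<close> at \<open>mstar M\<close> is the adjoint of \<open>p\<close> at
  \<open>M\<close>. Assignments of the form \<open>mletters c X\<close> are fixed by it.\<close>

definition mstar :: "(ltr \<Rightarrow> nat \<Rightarrow> nat \<Rightarrow> 'f) \<Rightarrow> ltr \<Rightarrow> nat \<Rightarrow> nat \<Rightarrow> 'f" where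
  "mstar M l = madj c (M (lstar l))"

lemma mstar_mletters: "mstar (mletters c X) = mletters c X"
  by (rule ext) (simp add: mstar_def mletters_def madj_def split: ltr.split)

lemma mv_adjoint: "(\<Sum>i<n. mv n A u i * c (v i)) = (\<Sum>i<n. u i * c (mv n (madj c A) v i))"
proof -
  have "(\<Sum>i<n. mv n A u i * c (v i)) = (\<Sum>i<n. \<Sum>k<n. A i k * u k * c (v i))"
    by (simp add: mv_def sum_distrib_right)
  also have "\<dots> = (\<Sum>k<n. \<Sum>i<n. A i k * u k * c (v i))" by (rule sum.swap)
  finally show ?thesis
    by (simp add: mv_def sum_distrib_left c_sum c_mult madj_def mult_ac)
qed

lemma vw_adjoint: "(\<Sum>i<n. vw n M w u i * c (v i)) = (\<Sum>i<n. u i * c (vw n (mstar M) (wstar w) v i))"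
proof (induction w arbitrary: v)
  case (Cons l w)
  have "(\<Sum>i<n. vw n M (l # w) u i * c (v i))
      = (\<Sum>i<n. vw n M w u i * c (mv n (mstar M (lstar l)) v i))"
    by (simp add: mv_adjoint mstar_def)
  also have "\<dots> = (\<Sum>i<n. u i * c (vw n (mstar M) (wstar (l # w)) v i))"
    by (simp add: Cons.IH wstar_Cons vw_append)
  finally show ?case .
qed (simp add: wstar_def)

lemma vev_adjoint: "(\<Sum>i<n. vev n M p u i * c (v i)) = (\<Sum>i<n. u i * c (vev n (mstar M) (pstar c p) v i))"
proof -
  have "{w. pstar c p w \<noteq> 0} = wstar ` {w. p w \<noteq> 0}"
    by (auto simp: pstar_def image_iff) (metis wstar_wstar)
  moreover have "inj wstar" by (metis injI wstar_wstar)
  ultimately have v: "vev n (mstar M) (pstar c p) v i = (\<Sum>w | p w \<noteq> 0. c (p w) * vw n (mstar M) (wstar w) v i)" for i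
    unfolding vev_def by (simp add: sum.reindex inj_on_subset pstar_def)
  have "(\<Sum>i<n. vev n M p u i * c (v i)) = (\<Sum>i<n. \<Sum>w | p w \<noteq> 0. p w * (vw n M w u i * c (v i)))"
    by (simp add: vev_def sum_distrib_left mult_ac)
  also have "\<dots> = (\<Sum>w | p w \<noteq> 0. p w * (\<Sum>i<n. vw n M w u i * c (v i)))"
    by (subst sum.swap) (simp add: sum_distrib_left)
  also have "\<dots> = (\<Sum>w | p w \<noteq> 0. \<Sum>i<n. p w * (u i * c (vw n (mstar M) (wstar w) v i)))"
    by (simp add: vw_adjoint sum_distrib_left)
  also have "\<dots> = (\<Sum>i<n. u i * c (vev n (mstar M) (pstar c p) v i))"
    by (subst sum.swap) (simp add: v c_sum c_mult sum_distrib_left mult_ac)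
  finally show ?thesis .
qed

lemma kills_pstar:
  assumes "kills n M p"
  shows "kills n (mstar M) (pstar c p)"
  unfolding kills_def
proof (intro allI impI)
  fix v i assume i: "i < n"
  have "0 = (\<Sum>k<n. vev n M p (\<lambda>k. if k = i then 1 else 0) k * c (v k))"
    using assms by (simp add: kills_def)
  also have "\<dots> = (\<Sum>k<n. (if k = i then 1 else 0) * c (vev n (mstar M) (pstar c p) v k))"
    by (rule vev_adjoint)
  also have "\<dots> = (\<Sum>k<n. if k = i then c (vev n (mstar M) (pstar c p) v k) else 0)"
    by (intro sum.cong) auto
  also have "\<dots> = c (vev n (mstar M) (pstar c p) v i)" using i by simp
  finally show "vev n (mstar M) (pstar c p) v i = 0" by simp
qed

text \<open>Reduces the vanishing of a generated star ideal at a genuine matrix tuple to the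
  vanishing of its generators. Closure under the involution rests on \<open>mletters c X\<close>
  being a fixed point of \<open>mstar\<close>.\<close>

lemma star_ideal_kills: "star_ideal g c {p \<in> polys g. kills n (mletters c X) p}"
  unfolding star_ideal_def
proof (intro conjI ballI)
  show "(\<lambda>w. 0) \<in> {p \<in> polys g. kills n (mletters c X) p}"
    by (simp add: zero_polys kills_def vev_def)
  show "padd p q \<in> {p \<in> polys g. kills n (mletters c X) p}"
    if "p \<in> {p \<in> polys g. kills n (mletters c X) p}" "q \<in> {p \<in> polys g. kills n (mletters c X) p}" for p q
    using that kills_padd padd_polys by blast
  show "pstar c p \<in> {p \<in> polys g. kills n (mletters c X) p}"
    if "p \<in> {p \<in> polys g. kills n (mletters c X) p}" for p
    using that kills_pstar[of n "mletters c X" p] by (simp add: pstar_polys mstar_mletters)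
  show "pmult a (pmult p b) \<in> {p \<in> polys g. kills n (mletters c X) p}"
    if p: "p \<in> {p \<in> polys g. kills n (mletters c X) p}" and a: "a \<in> polys g" and b: "b \<in> polys g" for p a b
  proof -
    have pb: "pmult p b \<in> polys g" using p b by (simp add: pmult_polys)
    have "vev n (mletters c X) (pmult a (pmult p b)) u i = 0" if i: "i < n" for u i
    proof -
      have "vev n (mletters c X) (pmult a (pmult p b)) u i
          = vev n (mletters c X) a (vev n (mletters c X) (pmult p b) u) i"
        using a pb by (intro vev_pmult) (simp_all add: polys_finite)
      also have "\<dots> = 0"
      proof (rule vev_zero_vec[OF _ i])
        fix k assume "k < n"
        then show "vev n (mletters c X) (pmult p b) u k = 0"
          using p b vev_pmult[OF polys_finite polys_finite, of p g b g] by (simp add: kills_def)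
      qed
      finally show ?thesis .
    qed
    then show ?thesis using a pb by (simp add: pmult_polys kills_def)
  qed
qed auto

end

section \<open>The truncated regular representation\<close>

text \<open>\<open>B\<close> is a largest set of words in \<open>W\<close> supporting no nonzero
  element of \<open>J\<close>. Adding a word \<open>w\<close> to it creates an element of
  \<open>J\<close> with nonzero coefficient at \<open>w\<close>; dividing by that coefficient
  expresses \<open>w\<close> modulo \<open>J\<close> through \<open>B\<close>, with coordinates
  \<open>coef w\<close>.\<close>

lemma normal_form_exists:
  fixes J :: "('a \<Rightarrow> 'f::field) set"
  assumes "finite W" and scale: "\<And>a p. p \<in> J \<Longrightarrow> (\<lambda>w. a * p w) \<in> J"
    and zero: "(\<lambda>w. 0) \<in> J"
  obtains B coef where "B \<subseteq> W" "\<And>w b. w \<in> W \<Longrightarrow> coef w b \<noteq> 0 \<Longrightarrow> b \<in> B"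
    "\<And>w. w \<in> W \<Longrightarrow> (\<lambda>v. (if v = w then 1 else 0) - coef w v) \<in> J"
    "\<And>b. b \<in> B \<Longrightarrow> coef b = (\<lambda>v. if v = b then 1 else 0)"
    "\<And>p. p \<in> J \<Longrightarrow> {w. p w \<noteq> 0} \<subseteq> B \<Longrightarrow> p = (\<lambda>w. 0)"
proof -
  define indep where "indep B \<longleftrightarrow> B \<subseteq> W \<and> (\<forall>p\<in>J. {w. p w \<noteq> 0} \<subseteq> B \<longrightarrow> p = (\<lambda>w. 0))" for B
  have "indep {}" by (auto simp: indep_def)
  moreover have "\<forall>B. indep B \<longrightarrow> card B < Suc (card W)"
    using assms(1) by (auto simp: indep_def less_Suc_eq_le card_mono)
  ultimately obtain B where B: "indep B" and max: "\<And>B'. indep B' \<Longrightarrow> card B' \<le> card B"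
    using ex_has_greatest_nat[of indep "{}" card] by blast
  have fB: "finite B" using B assms(1) finite_subset by (auto simp: indep_def)
  have ex: "\<exists>f. (\<forall>b. f b \<noteq> 0 \<longrightarrow> b \<in> B) \<and> (\<lambda>v. (if v = w then 1 else 0) - f v) \<in> J
     \<and> (w \<in> B \<longrightarrow> f = (\<lambda>v. if v = w then 1 else 0))" if w: "w \<in> W" for w
  proof (cases "w \<in> B")
    case True
    then show ?thesis using zero by (intro exI[of _ "\<lambda>v. if v = w then 1 else 0"]) auto
  next
    case False
    have "\<not> indep (insert w B)" using max[of "insert w B"] False fB by auto
    then obtain p where p: "p \<in> J" "{v. p v \<noteq> 0} \<subseteq> insert w B" "p \<noteq> (\<lambda>w. 0)"
      using B w by (auto simp: indep_def)
    have "p w \<noteq> 0"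
    proof
      assume "p w = 0"
      then have "{v. p v \<noteq> 0} \<subseteq> B" using p(2) by auto
      then show False using B p by (auto simp: indep_def)
    qed
    let ?f = "\<lambda>v. (if v = w then 1 else 0) - inverse (p w) * p v"
    have "(\<lambda>v. (if v = w then 1 else 0) - ?f v) \<in> J" using scale[OF p(1), of "inverse (p w)"] by simp
    moreover have "b \<in> B" if "?f b \<noteq> 0" for b
      using that p(2) \<open>p w \<noteq> 0\<close> by (cases "b = w") auto
    ultimately show ?thesis using False by (intro exI[of _ ?f]) blast
  qed
  then obtain coef where "\<And>w. w \<in> W \<Longrightarrow> (\<forall>b. coef w b \<noteq> 0 \<longrightarrow> b \<in> B)
     \<and> (\<lambda>v. (if v = w then 1 else 0) - coef w v) \<in> J
     \<and> (w \<in> B \<longrightarrow> coef w = (\<lambda>v. if v = w then 1 else 0))" by metis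
  moreover have "B \<subseteq> W" using B by (simp add: indep_def)
  ultimately show ?thesis using that[of B coef] B unfolding indep_def by blast
qed

definition words_upto :: "nat \<Rightarrow> nat \<Rightarrow> ltr list set" where
  "words_upto g N = {w. length w \<le> N \<and> (\<forall>l\<in>set w. lidx l < g)}"

lemma finite_words_upto: "finite (words_upto g N)"
proof -
  have "{l. lidx l < g} \<subseteq> Lx ` {..<g} \<union> Ls ` {..<g}"
  proof
    fix l assume "l \<in> {l. lidx l < g}"
    then show "l \<in> Lx ` {..<g} \<union> Ls ` {..<g}" by (cases l) auto
  qed
  then have "finite {l. lidx l < g}" by (rule finite_subset) simp
  then have "finite {w. set w \<subseteq> {l. lidx l < g} \<and> length w \<le> N}"
    by (rule finite_lists_length_le)
  then show ?thesis by (rule rev_finite_subset) (auto simp: words_upto_def)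
qed

definition lmul :: "ltr list \<Rightarrow> (ltr list \<Rightarrow> 'f::real_normed_field) \<Rightarrow> ltr list \<Rightarrow> 'f" where
  "lmul u p = (\<lambda>w. if take (length u) w = u then p (drop (length u) w) else 0)"

lemma pmult_single: "pmult (single u) p = lmul u p"
proof
  fix w
  have "pmult (single u) p w = (\<Sum>k\<le>length w. if k = length u then lmul u p w else 0)"
    unfolding pmult_def
  proof (intro sum.cong refl)
    fix k assume "k \<in> {..length w}"
    then have "length (take k w) = k" by simp
    then show "single u (take k w) * p (drop k w) = (if k = length u then lmul u p w else 0)"
      by (auto simp: single_def lmul_def)
  qed
  moreover have "lmul u p w = 0" if "\<not> length u \<le> length w"
    using that by (auto simp: lmul_def dest: arg_cong[of _ _ length])
  ultimately show "pmult (single u) p w = lmul u p w" by (auto simp: sum.delta)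
qed

lemma lmul_Cons: "lmul (l # u) p = lmul [l] (lmul u p)"
proof
  fix w
  show "lmul (l # u) p w = lmul [l] (lmul u p) w"
    by (cases w) (auto simp: lmul_def)
qed

lemma pmult_eq_sum_lmul:
  assumes "finite {w. p w \<noteq> 0}"
  shows "pmult p q w = (\<Sum>u | p u \<noteq> 0. p u * lmul u q w)"
proof -
  have "(\<Sum>u | p u \<noteq> 0. p u * lmul u q w) = (\<Sum>u | p u \<noteq> 0. \<Sum>k\<le>length w. p u * (single u (take k w) * q (drop k w)))"
    by (simp add: pmult_single[symmetric] pmult_def sum_distrib_left)
  also have "\<dots> = (\<Sum>k\<le>length w. \<Sum>u | p u \<noteq> 0. p u * (single u (take k w) * q (drop k w)))"
    by (rule sum.swap)
  also have "\<dots> = (\<Sum>k\<le>length w. \<Sum>u | p u \<noteq> 0. if u = take k w then p (take k w) * q (drop k w) else 0)"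
    by (intro sum.cong refl) (auto simp: single_def)
  also have "\<dots> = pmult p q w"
    unfolding pmult_def using assms by (intro sum.cong refl) (auto simp: sum.delta)
  finally show ?thesis by simp
qed

context conj_field
begin

text \<open>The quotient of the polynomials by \<open>I\<close> and all words longer than \<open>N\<close> is finite-dimensional;
  left multiplication by the letters on it gives the matrices \<open>M\<close>, and \<open>u\<close> is the class of \<open>1\<close>.\<close>

lemma truncated_regular_representation:
  assumes I: "star_ideal g c I" and wtI: "\<And>\<phi> p. p \<in> I \<Longrightarrow> wt \<phi> p \<in> I"
  obtains m :: nat and M :: "ltr \<Rightarrow> nat \<Rightarrow> nat \<Rightarrow> 'f" and u :: "nat \<Rightarrow> 'f"
  where "\<And>q. q \<in> I \<Longrightarrow> kills m M q"
    and "\<And>p. p \<in> polys g \<Longrightarrow> (\<And>w. p w \<noteq> 0 \<Longrightarrow> length w \<le> N) \<Longrightarrow>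
           (\<And>i. i < m \<Longrightarrow> vev m M p u i = 0) \<Longrightarrow> p \<in> I"
proof -
  define W where "W = words_upto g N"
  have fW: "finite W" by (simp add: W_def finite_words_upto)
  have Wpolys: "p \<in> polys g" if "{w. p w \<noteq> 0} \<subseteq> W" for p :: "ltr list \<Rightarrow> 'f"
  proof -
    have "finite {w. p w \<noteq> 0}" using that fW finite_subset by blast
    then show ?thesis using that by (auto simp: polys_def W_def words_upto_def)
  qed
  have polysW: "w \<in> W" if "p \<in> polys g" "p w \<noteq> 0" "length w \<le> N" for p :: "ltr list \<Rightarrow> 'f" and w
    using that polys_lidx by (auto simp: W_def words_upto_def)
  \<comment> \<open>The part of the ideal in degrees at most \<open>N\<close>. Words in the
    resulting set \<open>B\<close> represent a basis of the truncated quotient.\<close>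
  let ?J = "{p \<in> I. {w. p w \<noteq> 0} \<subseteq> W}"
  have J: "(\<lambda>w. 0) \<in> ?J" "\<And>a p. p \<in> ?J \<Longrightarrow> (\<lambda>w. a * p w) \<in> ?J"
    using star_idealD(2,7)[OF I] by auto
  obtain B coef where BW: "B \<subseteq> W" and coefB: "\<And>w b. w \<in> W \<Longrightarrow> coef w b \<noteq> 0 \<Longrightarrow> b \<in> B"
    and coefJ: "\<And>w. w \<in> W \<Longrightarrow> (\<lambda>v. (if v = w then 1 else 0) - coef w v) \<in> ?J"
    and coef_B: "\<And>b. b \<in> B \<Longrightarrow> coef b = (\<lambda>v. if v = b then 1 else 0)"
    and BJ: "\<And>p. p \<in> ?J \<Longrightarrow> {w. p w \<noteq> 0} \<subseteq> B \<Longrightarrow> p = (\<lambda>w. 0)"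
    using normal_form_exists[OF fW J(2) J(1)] by blast
  have fB: "finite B" using BW fW finite_subset by blast
  \<comment> \<open>\<open>\<tau>\<close> discards the words outside \<open>W\<close>;
    \<open>\<nu>\<close> moreover replaces each remaining word by its normal form. So
    \<open>\<nu> p\<close> is the class of \<open>p\<close> in the quotient, written in the basis
    \<open>B\<close>.\<close>
  define \<nu> where "\<nu> p = (\<lambda>b. \<Sum>w\<in>W. p w * coef w b)" for p :: "ltr list \<Rightarrow> 'f"
  define \<tau> where "\<tau> p = (\<lambda>w. if w \<in> W then p w else 0)" for p :: "ltr list \<Rightarrow> 'f"
  have \<nu>B: "b \<in> B" if nz: "\<nu> p b \<noteq> 0" for p b
  proof -
    obtain w where "w \<in> W" "p w * coef w b \<noteq> 0"
      using sum.not_neutral_contains_not_neutral[OF nz[unfolded \<nu>_def]] by blast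
    then show ?thesis using coefB by auto
  qed
  have \<nu>_polys: "\<nu> p \<in> polys g" for p using \<nu>B BW by (intro Wpolys) blast
  have \<nu>_\<tau>: "\<nu> (\<tau> p) = \<nu> p" for p by (simp add: \<nu>_def \<tau>_def)
  have \<nu>_sum: "\<nu> (\<lambda>w. \<Sum>k\<in>K. a k * f k w) b = (\<Sum>k\<in>K. a k * \<nu> (f k) b)"
    for K :: "ltr list set" and a f b
  proof -
    have "\<nu> (\<lambda>w. \<Sum>k\<in>K. a k * f k w) b = (\<Sum>w\<in>W. \<Sum>k\<in>K. a k * (f k w * coef w b))"
      by (simp add: \<nu>_def sum_distrib_left mult_ac)
    also have "\<dots> = (\<Sum>k\<in>K. \<Sum>w\<in>W. a k * (f k w * coef w b))" by (rule sum.swap)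
    finally show ?thesis by (simp add: \<nu>_def sum_distrib_left)
  qed
  have \<nu>_diff: "\<nu> (\<lambda>w. p w - q w) b = \<nu> p b - \<nu> q b" for p q b
    by (simp add: \<nu>_def algebra_simps sum_subtractf)
  have \<tau>I: "(\<lambda>w. \<tau> p w - \<nu> p w) \<in> I" for p
  proof -
    have "(\<lambda>v. \<Sum>w\<in>W. p w * ((if v = w then 1 else 0) - coef w v)) \<in> I"
      by (intro star_ideal_sum[OF I] star_idealD(7)[OF I]) (use coefJ in blast)
    moreover have "(\<Sum>w\<in>W. p w * ((if v = w then 1 else 0) - coef w v)) = \<tau> p v - \<nu> p v" for v
    proof -
      have "(\<Sum>w\<in>W. p w * (if v = w then 1 else 0)) = (\<Sum>w\<in>W. if v = w then p v else 0)"
        by (intro sum.cong) auto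
      then show ?thesis
        using fW by (simp add: \<tau>_def \<nu>_def right_diff_distrib sum_subtractf)
    qed
    ultimately show ?thesis by simp
  qed
  \<comment> \<open>Gradedness enters here: truncating \<open>q\<close> keeps it in
    \<open>I\<close>, so its normal form lies in \<open>I\<close>, is supported on \<open>B\<close>,
    and must vanish.\<close>
  have \<nu>I: "\<nu> q = (\<lambda>w. 0)" if q: "q \<in> I" for q
  proof (rule BJ)
    have "\<tau> q = wt (\<lambda>d. if d \<le> N then 1 else 0) q"
    proof
      fix w
      have "q \<in> polys g" using star_idealD(1)[OF I] q by blast
      then show "\<tau> q w = wt (\<lambda>d. if d \<le> N then 1 else 0) q w"
        using polysW[of q w] by (auto simp: \<tau>_def wt_def W_def words_upto_def)
    qed
    then have "\<tau> q \<in> I" using wtI[OF q] by simp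
    from star_ideal_diff[OF I this \<tau>I[of q]] have "\<nu> q \<in> I" by simp
    then show "\<nu> q \<in> ?J" using \<nu>B BW by blast
    show "{w. \<nu> q w \<noteq> 0} \<subseteq> B" using \<nu>B by blast
  qed
  \<comment> \<open>The matrix of left multiplication by \<open>l\<close> in the basis
    \<open>B\<close>. The default value 0 is the class of a product that leaves \<open>W\<close>,
    such as one longer than \<open>N\<close>.\<close>
  define A where "A l b' b = (if l # b \<in> W then coef (l # b) b' else 0)" for l b' b
  have A: "(\<Sum>b\<in>B. A l b' b * \<nu> p b) = \<nu> (lmul [l] p) b'" if l: "lidx l < g" for l p b'
  proof -
    \<comment> \<open>\<open>W\<close> contains the tail of each of its words, so the normal form of
      \<open>l\<close> times \<open>r\<close> depends only on the coefficients of \<open>r\<close>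
      on \<open>W\<close>.\<close>
    have sh: "\<nu> (lmul [l] r) b' = (\<Sum>b\<in>W. A l b' b * r b)" for r
    proof -
      let ?V = "{b \<in> W. l # b \<in> W}"
      have "\<nu> (lmul [l] r) b' = (\<Sum>w\<in>(#) l ` ?V. lmul [l] r w * coef w b')"
        unfolding \<nu>_def
      proof (rule sum.mono_neutral_right[OF fW])
        show "(#) l ` ?V \<subseteq> W" by auto
        show "\<forall>w\<in>W - (#) l ` ?V. lmul [l] r w * coef w b' = 0"
        proof
          fix w assume w: "w \<in> W - (#) l ` ?V"
          have "lmul [l] r w = 0"
          proof (cases w)
            case (Cons a v)
            then have "v \<in> W" using w by (auto simp: W_def words_upto_def)
            then have "a \<noteq> l" using w Cons by auto
            then show ?thesis using Cons by (simp add: lmul_def)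
          qed (simp add: lmul_def)
          then show "lmul [l] r w * coef w b' = 0" by simp
        qed
      qed
      also have "\<dots> = (\<Sum>b\<in>?V. A l b' b * r b)"
        by (subst sum.reindex) (auto simp: lmul_def A_def intro!: sum.cong)
      also have "\<dots> = (\<Sum>b\<in>W. A l b' b * r b)"
        by (rule sum.mono_neutral_left) (use fW in \<open>auto simp: A_def\<close>)
      finally show ?thesis .
    qed
    have "(\<Sum>b\<in>B. A l b' b * \<nu> p b) = (\<Sum>b\<in>W. A l b' b * \<nu> p b)"
      by (rule sum.mono_neutral_left) (use fW BW \<nu>B in auto)
    also have "\<dots> = \<nu> (lmul [l] (\<nu> p)) b'" by (simp add: sh)
    \<comment> \<open>Truncation and normal form differ by an element of \<open>I\<close>, and
      \<open>I\<close> absorbs left multiplication.\<close>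
    also have "\<dots> = \<nu> (lmul [l] (\<tau> p)) b'"
    proof -
      have "single [l] \<in> polys g" by (rule single_polys) (use l in auto)
      from star_idealD(5)[OF I \<tau>I[of p] this]
      have "lmul [l] (\<lambda>w. \<tau> p w - \<nu> p w) \<in> I" by (simp add: pmult_single)
      moreover have "lmul [l] (\<lambda>w. \<tau> p w - \<nu> p w) = (\<lambda>w. lmul [l] (\<tau> p) w - lmul [l] (\<nu> p) w)"
        by (auto simp: lmul_def)
      ultimately have "\<nu> (\<lambda>w. lmul [l] (\<tau> p) w - lmul [l] (\<nu> p) w) b' = 0"
        using \<nu>I by simp
      then show ?thesis by (simp add: \<nu>_diff)
    qed
    also have "\<dots> = \<nu> (lmul [l] p) b'"
      by (simp add: sh \<tau>_def)
    finally show ?thesis .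
  qed
  define m where "m = card B"
  obtain h where h: "bij_betw h {..<m} B"
    using ex_bij_betw_nat_finite[OF fB] by (auto simp: m_def atLeast0LessThan)
  define M where "M l i k = A l (h i) (h k)" for l i k
  have word: "vw m M w (\<lambda>i. \<nu> p (h i)) = (\<lambda>i. \<nu> (lmul w p) (h i))" if "\<forall>l\<in>set w. lidx l < g" for w p
    using that
  proof (induction w)
    case (Cons l w)
    show ?case
    proof
      fix i
      have "vw m M (l # w) (\<lambda>i. \<nu> p (h i)) i = mv m (M l) (\<lambda>i. \<nu> (lmul w p) (h i)) i"
        using Cons by simp
      also have "\<dots> = (\<Sum>k<m. A l (h i) (h k) * \<nu> (lmul w p) (h k))"
        by (simp add: mv_def M_def)
      also have "\<dots> = (\<Sum>b\<in>B. A l (h i) b * \<nu> (lmul w p) b)"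
        by (rule sum.reindex_bij_betw[OF h])
      also have "\<dots> = \<nu> (lmul (l # w) p) (h i)"
        using Cons A[of l] by (simp add: lmul_Cons[of l w])
      finally show "vw m M (l # w) (\<lambda>i. \<nu> p (h i)) i = \<nu> (lmul (l # w) p) (h i)" .
    qed
  qed (simp add: lmul_def)
  have ev: "vev m M q (\<lambda>i. \<nu> p (h i)) i = \<nu> (pmult q p) (h i)" if q: "q \<in> polys g" for q p i
  proof -
    have "vev m M q (\<lambda>i. \<nu> p (h i)) i = (\<Sum>w | q w \<noteq> 0. q w * \<nu> (lmul w p) (h i))"
      unfolding vev_def using polys_lidx[OF q] by (intro sum.cong refl) (auto simp: word)
    also have "\<dots> = \<nu> (\<lambda>v. \<Sum>w | q w \<noteq> 0. q w * lmul w p v) (h i)" by (simp add: \<nu>_sum)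
    also have "\<dots> = \<nu> (pmult q p) (h i)"
      by (intro arg_cong[where f = "\<lambda>x. \<nu> x (h i)"] ext)
        (simp add: pmult_eq_sum_lmul[OF polys_finite[OF q]])
    finally show ?thesis .
  qed
  show thesis
  \<comment> \<open>The class of 1 is the test vector: \<open>ev\<close> sends it under
    \<open>p\<close> to the class of \<open>p\<close>. If that class is zero and \<open>p\<close>
    has degree at most \<open>N\<close>, then \<open>p\<close> equals its truncation and lies in
    \<open>I\<close>.\<close>
  proof (rule that[of m M "\<lambda>i. \<nu> (single []) (h i)"])
    fix q assume q: "q \<in> I"
    then have qp: "q \<in> polys g" using star_idealD(1)[OF I] by blast
    show "kills m M q"
    proof (rule kills_basis)
      fix i j assume i: "i < m" and j: "j < m"
      have hj: "h j \<in> B" using h j by (auto simp: bij_betw_def)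
      have "vev m M q (\<lambda>i. if i = j then 1 else 0) i = vev m M q (\<lambda>i. \<nu> (single (h j)) (h i)) i"
      proof (rule vev_cong[OF _ i])
        fix k assume k: "k < m"
        have "\<nu> (single (h j)) (h k) = (\<Sum>w\<in>W. if w = h j then coef (h j) (h k) else 0)"
          unfolding \<nu>_def by (intro sum.cong) (auto simp: single_def)
        also have "\<dots> = (if h k = h j then 1 else 0)"
          using hj BW fW coef_B[OF hj] by (auto simp: subset_iff)
        also have "\<dots> = (if k = j then 1 else 0)"
          using h j k by (auto simp: bij_betw_def inj_on_def)
        finally show "(if k = j then 1 else 0) = \<nu> (single (h j)) (h k)" by simp
      qed
      also have "\<dots> = \<nu> (pmult q (single (h j))) (h i)" by (rule ev[OF qp])
      also have "\<dots> = 0"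
      proof -
        have "single (h j) \<in> polys g"
          using hj BW by (intro single_polys) (auto simp: W_def words_upto_def)
        then have "pmult q (single (h j)) \<in> I" by (rule star_idealD(6)[OF I q])
        then show ?thesis using \<nu>I by simp
      qed
      finally show "vev m M q (\<lambda>i. if i = j then 1 else 0) i = 0" .
    qed
  next
    fix p assume p: "p \<in> polys g" and deg: "\<And>w. p w \<noteq> 0 \<Longrightarrow> length w \<le> N"
      and z: "\<And>i. i < m \<Longrightarrow> vev m M p (\<lambda>i. \<nu> (single []) (h i)) i = 0"
    have "\<nu> p b = 0" for b
    proof (cases "b \<in> B")
      case True
      then obtain i where "i < m" "b = h i" using h by (auto simp: bij_betw_def)
      then show ?thesis using z[of i] ev[OF p, of "single []" i] by simp
    qed (use \<nu>B in blast)
    moreover have "\<tau> p = p"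
    proof
      fix w show "\<tau> p w = p w" using polysW[OF p _ deg, of w] by (auto simp: \<tau>_def)
    qed
    ultimately show "p \<in> I" using \<tau>I[of p] by simp
  qed
qed

end

section \<open>Doubling\<close>

definition laurent :: "('f::field \<Rightarrow> 'f) \<Rightarrow> bool" where
  "laurent f \<longleftrightarrow> (\<exists>P k. \<forall>q. q \<noteq> 0 \<longrightarrow> q ^ k * f q = poly P q)"

lemma laurent_const: "laurent (\<lambda>q. a)"
  unfolding laurent_def by (rule exI[of _ "[:a:]"], rule exI[of _ 0]) simp

lemma laurent_id: "laurent (\<lambda>q. q)"
  unfolding laurent_def by (rule exI[of _ "[:0,1:]"], rule exI[of _ 0]) simp

lemma laurent_inverse: "laurent inverse"
  unfolding laurent_def by (rule exI[of _ "[:1:]"], rule exI[of _ 1]) simp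

lemma laurent_mult:
  assumes "laurent f" "laurent h"
  shows "laurent (\<lambda>q. f q * h q)"
proof -
  obtain P k Q j where *: "\<And>q. q \<noteq> 0 \<Longrightarrow> q ^ k * f q = poly P q" "\<And>q. q \<noteq> 0 \<Longrightarrow> q ^ j * h q = poly Q q"
    using assms unfolding laurent_def by blast
  have "q ^ (k + j) * (f q * h q) = poly (P * Q) q" if "q \<noteq> 0" for q
    by (simp add: power_add mult_ac flip: *[OF that])
  then show ?thesis unfolding laurent_def by blast
qed

lemma laurent_add:
  assumes "laurent f" "laurent h"
  shows "laurent (\<lambda>q. f q + h q)"
proof -
  obtain P k Q j where *: "\<And>q. q \<noteq> 0 \<Longrightarrow> q ^ k * f q = poly P q" "\<And>q. q \<noteq> 0 \<Longrightarrow> q ^ j * h q = poly Q q"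
    using assms unfolding laurent_def by blast
  have "q ^ (k + j) * (f q + h q) = poly (monom 1 j * P + monom 1 k * Q) q" if "q \<noteq> 0" for q
    by (simp add: power_add poly_monom algebra_simps flip: *[OF that])
  then show ?thesis unfolding laurent_def by blast
qed

lemma laurent_sum: "(\<And>k. k \<in> K \<Longrightarrow> laurent (f k)) \<Longrightarrow> laurent (\<lambda>q. \<Sum>k\<in>K. f k q)"
  by (induction K rule: infinite_finite_induct) (auto intro: laurent_const laurent_add)

text \<open>Clearing denominators leaves a polynomial that is nonzero because of its value at
  \<open>a\<close>, so it has finitely many roots. This carries nonvanishing from the parameter -1
  over to positive parameters.\<close>

lemma laurent_finite_zeros:
  assumes "laurent f" "a \<noteq> 0" "f a \<noteq> 0"
  shows "finite {q. q \<noteq> 0 \<and> f q = 0}"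
proof -
  obtain P k where P: "\<And>q. q \<noteq> 0 \<Longrightarrow> q ^ k * f q = poly P q"
    using assms unfolding laurent_def by blast
  have "poly P a \<noteq> 0" using P[of a] assms by (metis mult_eq_0_iff power_eq_0_iff)
  then have "P \<noteq> 0" by auto
  then have "finite {q. poly P q = 0}" by (rule poly_roots_finite)
  moreover have "{q. q \<noteq> 0 \<and> f q = 0} \<subseteq> {q. poly P q = 0}" using P by force
  ultimately show ?thesis by (rule rev_finite_subset)
qed

lemma mv_double: "mv (2 * m) A u i = (\<Sum>k<m. A i k * u k + A i (m + k) * u (m + k))"
proof -
  have "{..<2 * m} = {..<m} \<union> (+) m ` {..<m}"
  proof (intro set_eqI iffI)
    fix x assume "x \<in> {..<2 * m}"
    then have "x < m \<or> (x = m + (x - m) \<and> x - m < m)" by auto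
    then show "x \<in> {..<m} \<union> (+) m ` {..<m}" by blast
  qed auto
  then have "mv (2 * m) A u i = (\<Sum>k\<in>{..<m} \<union> (+) m ` {..<m}. A i k * u k)" by (simp add: mv_def)
  also have "\<dots> = (\<Sum>k<m. A i k * u k) + (\<Sum>k\<in>(+) m ` {..<m}. A i k * u k)"
    by (rule sum.union_disjoint) auto
  also have "(\<Sum>k\<in>(+) m ` {..<m}. A i k * u k) = (\<Sum>k<m. A i (m + k) * u (m + k))"
    by (subst sum.reindex) auto
  finally show ?thesis by (simp add: sum.distrib)
qed

context conj_field
begin

text \<open>Write \<open>A = M (Lx j)\<close>, \<open>B = M (Ls j)\<close> for \<open>m \<times> m\<close> matrices that need not be adjoint to each
  other. Then \<open>dbl\<close> is the block matrix \<open>\<onehalf> [[A + B\<^sup>*, r(A - B\<^sup>*)], [(A - B\<^sup>*)/r, A + B\<^sup>*]]\<close>, which is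
  similar to the direct sum of \<open>A\<close> and \<open>B\<^sup>*\<close>. Conjugating it and its adjoint by \<open>diag(1, r)\<close> gives
  \<open>dblz\<close> at \<open>q = r\<^sup>2\<close>; at the inaccessible value \<open>q = -1\<close> the pair is similar to the
  direct sum of \<open>(A, B)\<close> and \<open>(B\<^sup>*, A\<^sup>*)\<close>.\<close>

definition dbl :: "nat \<Rightarrow> 'f \<Rightarrow> (ltr \<Rightarrow> nat \<Rightarrow> nat \<Rightarrow> 'f) \<Rightarrow> nat \<Rightarrow> nat \<Rightarrow> nat \<Rightarrow> 'f" where
  "dbl m r M j i k = (let a = M (Lx j) (i mod m) (k mod m); b = c (M (Ls j) (k mod m) (i mod m)) in
     if i < m \<longleftrightarrow> k < m then (a + b) / 2 else if i < m then r * (a - b) / 2 else (a - b) / (2 * r))"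

definition dblz :: "nat \<Rightarrow> 'f \<Rightarrow> (ltr \<Rightarrow> nat \<Rightarrow> nat \<Rightarrow> 'f) \<Rightarrow> ltr \<Rightarrow> nat \<Rightarrow> nat \<Rightarrow> 'f" where
  "dblz m q M l = (case l of Lx j \<Rightarrow> dbl m 1 M j | Ls j \<Rightarrow> (\<lambda>i k.
     let a = c (M (Lx j) (k mod m) (i mod m)); b = M (Ls j) (i mod m) (k mod m) in
     if i < m \<longleftrightarrow> k < m then (a + b) / 2 else if i < m then inverse q * (a - b) / 2 else q * (a - b) / 2))"

text \<open>The maps sending a pair of blocks \<open>(f, h)\<close> to \<open>f + r h\<close> and
  \<open>f - r h\<close> together diagonalise \<open>dbl\<close>: this one intertwines it with
  \<open>A\<close>, and \<open>dbl_minus\<close> is the other half, with the adjoint of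
  \<open>B\<close>.\<close>

lemma dbl_plus:
  assumes "r \<noteq> 0" "i < m"
  shows "mv (2 * m) (dbl m r M j) u i + r * mv (2 * m) (dbl m r M j) u (m + i)
       = mv m (M (Lx j)) (\<lambda>k. u k + r * u (m + k)) i"
  unfolding mv_double unfolding sum_distrib_left unfolding sum.distrib[symmetric] unfolding mv_def
  by (intro sum.cong refl) (use assms in \<open>simp add: dbl_def Let_def field_simps\<close>)

lemma dbl_minus:
  assumes "r \<noteq> 0" "i < m"
  shows "mv (2 * m) (dbl m r M j) u i - r * mv (2 * m) (dbl m r M j) u (m + i)
       = mv m (mstar M (Lx j)) (\<lambda>k. u k - r * u (m + k)) i"
  unfolding mv_double unfolding sum_distrib_left unfolding sum_subtractf[symmetric] unfolding mv_def
  by (intro sum.cong refl) (use assms in \<open>simp add: dbl_def mstar_def madj_def Let_def field_simps\<close>)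

text \<open>At \<open>q = -1\<close> the single map \<open>f + h\<close> intertwines both letters,
  with \<open>A\<close> and with \<open>B\<close>. Hence all mixed words in \<open>A\<close> and
  \<open>B\<close> are visible in the doubled pair, although these matrices are not adjoint to each
  other.\<close>

lemma dblz_minus_one:
  assumes "i < m"
  shows "mv (2 * m) (dblz m (-1) M l) u i + mv (2 * m) (dblz m (-1) M l) u (m + i)
       = mv m (M l) (\<lambda>k. u k + u (m + k)) i"
proof (cases l)
  case (Lx j)
  then show ?thesis using dbl_plus[of 1 i m M j u] assms by (simp add: dblz_def)
next
  case (Ls j)
  show ?thesis
    unfolding mv_double unfolding sum.distrib[symmetric] unfolding mv_def
    by (intro sum.cong refl) (use assms Ls in \<open>simp add: dblz_def Let_def field_simps\<close>)
qed

text \<open>Conjugation by the diagonal matrix with blocks 1 and \<open>r\<close>. Since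
  \<open>c r = r\<close>, taking the adjoint inverts nothing but the roles of \<open>r\<close> and
  \<open>1/r\<close> in the off-diagonal blocks, and the result depends on \<open>r\<close> through
  its square only.\<close>

lemma dblz_square:
  assumes "r \<noteq> 0" "c r = r" "i < 2 * m"
  shows "(if i < m then 1 else r) * mv (2 * m) (mletters c (dbl m r M) l) u i
       = mv (2 * m) (dblz m (r\<^sup>2) M l) (\<lambda>k. (if k < m then 1 else r) * u k) i"
  unfolding mv_def sum_distrib_left
proof (intro sum.cong refl)
  fix k
  show "(if i < m then 1 else r) * (mletters c (dbl m r M) l i k * u k)
      = dblz m (r\<^sup>2) M l i k * ((if k < m then 1 else r) * u k)"
    using assms(1,2)
    by (cases l; cases "i < m"; cases "k < m")
      (simp_all add: mletters_def madj_def dblz_def dbl_def Let_def c_divide c_mult c_add c_diff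
        power2_eq_square field_simps)
qed

text \<open>Only the starred letters involve \<open>q\<close>, through \<open>q\<close> and its
  inverse; words and polynomials are sums of products of such entries.\<close>

lemma laurent_vev_dblz: "laurent (\<lambda>q. vev n (dblz m q M) p u i)"
proof -
  have letter: "laurent (\<lambda>q. dblz m q M l i k)" for l i k
  proof (cases l)
    case (Ls j)
    let ?a = "c (M (Lx j) (k mod m) (i mod m))" and ?b = "M (Ls j) (i mod m) (k mod m)"
    have "laurent (\<lambda>q. inverse q * ((?a - ?b) / 2))"
      by (rule laurent_mult[OF laurent_inverse laurent_const])
    moreover have "laurent (\<lambda>q. q * ((?a - ?b) / 2))"
      by (rule laurent_mult[OF laurent_id laurent_const])
    ultimately show ?thesis
      using Ls by (cases "i < m"; cases "k < m") (simp_all add: dblz_def Let_def laurent_const)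
  qed (simp add: dblz_def laurent_const)
  have word: "laurent (\<lambda>q. vw n (dblz m q M) w u i)" for w i
  proof (induction w arbitrary: i)
    case Nil
    show ?case by (simp add: laurent_const)
  next
    case (Cons l w)
    show ?case unfolding vw.simps mv_def
      by (rule laurent_sum, rule laurent_mult[OF letter Cons])
  qed
  show ?thesis
    unfolding vev_def by (rule laurent_sum, rule laurent_mult[OF laurent_const word])
qed

text \<open>Nonvanishing of \<open>p\<close> at the pair \<open>(A, B)\<close> is nonvanishing of a
  Laurent polynomial at -1. Its zeros are finite in number and include the square of every
  admissible parameter at which the doubled tuple fails to detect \<open>p\<close>.\<close>

lemma kills_dbl_finite:
  assumes "i < m" "vev m M p u i \<noteq> 0"
  shows "finite {q. \<exists>r. r \<noteq> 0 \<and> c r = r \<and> q = r\<^sup>2 \<and> kills (2 * m) (mletters c (dbl m r M)) p}"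
proof -
  \<comment> \<open>The vector \<open>u\<close> in the first block and zero in the second, so that
    \<open>f + h\<close> gives back \<open>u\<close>; \<open>?F\<close> is that map applied after
    evaluating \<open>p\<close>.\<close>
  let ?v = "\<lambda>k. if k < m then u k else 0"
  let ?F = "\<lambda>q. vev (2 * m) (dblz m q M) p ?v i + vev (2 * m) (dblz m q M) p ?v (m + i)"
  have "1 * vev (2 * m) (dblz m (-1) M) p ?v i + 1 * vev (2 * m) (dblz m (-1) M) p ?v (m + i)
      = vev m M p (\<lambda>k. 1 * ?v k + 1 * ?v (m + k)) i"
    by (rule vev_intertwine[where P = "\<lambda>_. True" and \<alpha> = "\<lambda>_. 1" and \<beta> = "\<lambda>_. 1" and m = m])
      (use assms dblz_minus_one in auto)
  also have "\<dots> = vev m M p u i"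
    by (rule vev_cong) (use assms in auto)
  finally have "?F (-1) \<noteq> 0" using assms by simp
  moreover have "laurent ?F" by (intro laurent_add laurent_vev_dblz)
  ultimately have "finite {q. q \<noteq> 0 \<and> ?F q = 0}" by (intro laurent_finite_zeros[of ?F "-1"]) auto
  moreover have "?F (r\<^sup>2) = 0"
    if r: "r \<noteq> 0" "c r = r" and k: "kills (2 * m) (mletters c (dbl m r M)) p" for r
  proof -
    let ?\<alpha> = "\<lambda>k. if k < m then 1 else r"
    have "vev (2 * m) (dblz m (r\<^sup>2) M) p ?v i' = 0" if i': "i' < 2 * m" for i'
    proof -
      have "?\<alpha> i' * vev (2 * m) (mletters c (dbl m r M)) p ?v i' + 0 * vev (2 * m) (mletters c (dbl m r M)) p ?v (0 + i')
          = vev (2 * m) (dblz m (r\<^sup>2) M) p (\<lambda>k. ?\<alpha> k * ?v k + 0 * ?v (0 + k)) i'"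
        by (rule vev_intertwine[where P = "\<lambda>_. True" and \<alpha> = ?\<alpha> and \<beta> = "\<lambda>_. 0" and m = 0])
          (use i' dblz_square[OF r] in auto)
      also have "(\<lambda>k. ?\<alpha> k * ?v k + 0 * ?v (0 + k)) = ?v" by auto
      finally show ?thesis using k i' by (simp add: kills_def)
    qed
    then show ?thesis using assms(1) by simp
  qed
  then have "{q. \<exists>r. r \<noteq> 0 \<and> c r = r \<and> q = r\<^sup>2 \<and> kills (2 * m) (mletters c (dbl m r M)) p} \<subseteq> {q. q \<noteq> 0 \<and> ?F q = 0}"
    by auto
  ultimately show ?thesis by (rule rev_finite_subset)
qed

text \<open>An analytic polynomial meets only the matrices \<open>dbl\<close>, which are similar to
  direct sums of \<open>A\<close> and the adjoint of \<open>B\<close>. The combinations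
  \<open>f + r h\<close> and \<open>f - r h\<close> of its value vanish, and they determine both
  blocks.\<close>

lemma kills_dbl_analytic:
  assumes "r \<noteq> 0" "analytic s" "kills m M s" "kills m (mstar M) s"
  shows "kills (2 * m) (mletters c (dbl m r M)) s"
  unfolding kills_def
proof (intro allI impI)
  fix u i assume i: "i < 2 * m"
  let ?e = "vev (2 * m) (mletters c (dbl m r M)) s u"
  have P: "is_analytic_letter l" if "s w \<noteq> 0" "l \<in> set w" for w l
    using assms(2) that by (auto simp: analytic_def)
  have plus: "?e k + r * ?e (m + k) = 0" and minus: "?e k - r * ?e (m + k) = 0" if k: "k < m" for k
  proof -
    have "1 * ?e k + r * ?e (m + k) = vev m M s (\<lambda>k. 1 * u k + r * u (m + k)) k"
    proof (rule vev_intertwine[where P = is_analytic_letter and \<alpha> = "\<lambda>_. 1" and \<beta> = "\<lambda>_. r" and m = m, OF _ P k])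
      fix l u i assume "is_analytic_letter l" "i < m"
      then show "1 * mv (2 * m) (mletters c (dbl m r M) l) u i + r * mv (2 * m) (mletters c (dbl m r M) l) u (m + i)
          = mv m (M l) (\<lambda>i. 1 * u i + r * u (m + i)) i"
        using assms(1) by (cases l) (simp_all add: mletters_def dbl_plus)
    qed
    then show "?e k + r * ?e (m + k) = 0" using assms(3) k by (simp add: kills_def)
    have "1 * ?e k + (- r) * ?e (m + k) = vev m (mstar M) s (\<lambda>k. 1 * u k + (- r) * u (m + k)) k"
    proof (rule vev_intertwine[where P = is_analytic_letter and \<alpha> = "\<lambda>_. 1" and \<beta> = "\<lambda>_. - r" and m = m, OF _ P k])
      fix l u i assume "is_analytic_letter l" "i < m"
      then show "1 * mv (2 * m) (mletters c (dbl m r M) l) u i + (- r) * mv (2 * m) (mletters c (dbl m r M) l) u (m + i)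
          = mv m (mstar M l) (\<lambda>i. 1 * u i + (- r) * u (m + i)) i"
        using assms(1) by (cases l) (simp_all add: mletters_def dbl_minus)
    qed
    then show "?e k - r * ?e (m + k) = 0" using assms(4) k by (simp add: kills_def)
  qed
  have e: "?e k = 0 \<and> ?e (m + k) = 0" if "k < m" for k
  proof -
    have "2 * ?e k = (?e k + r * ?e (m + k)) + (?e k - r * ?e (m + k))" by simp
    also have "\<dots> = 0" using plus[OF that] minus[OF that] by simp
    finally have "?e k = 0" by simp
    then show ?thesis using plus[OF that] assms(1) by simp
  qed
  show "?e i = 0"
  proof (cases "i < m")
    case False
    then have "i = m + (i - m)" "i - m < m" using i by auto
    then show ?thesis using e by metis
  qed (use e in blast)
qed

end

section \<open>Hilbert space direct sums\<close>

text \<open>Coordinate \<open>i\<close> of the \<open>m\<close>-th summand of the Hilbert space direct sum of the spaces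
  \<open>F\<^sup>n\<^sup>(\<^sup>m\<^sup>)\<close> is stored at \<open>prod_encode (m, i)\<close>; entries with \<open>i \<ge> n m\<close> are zero.\<close>

definition bsq :: "(nat \<Rightarrow> nat) \<Rightarrow> (nat \<Rightarrow> 'f::real_normed_field) \<Rightarrow> nat \<Rightarrow> real" where
  "bsq n u m = (\<Sum>i<n m. (norm (u (prod_encode (m, i))))\<^sup>2)"

definition ell2 :: "(nat \<Rightarrow> nat) \<Rightarrow> (nat \<Rightarrow> 'f::real_normed_field) set" where
  "ell2 n = {u. (\<forall>m i. n m \<le> i \<longrightarrow> u (prod_encode (m, i)) = 0) \<and> summable (bsq n u)}"

definition opb :: "(nat \<Rightarrow> nat) \<Rightarrow> (nat \<Rightarrow> nat \<Rightarrow> nat \<Rightarrow> 'f::real_normed_field) \<Rightarrow> (nat \<Rightarrow> 'f) \<Rightarrow> nat \<Rightarrow> 'f" where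
  "opb n Z u = (\<lambda>a. case prod_decode a of (m, i) \<Rightarrow>
     if i < n m then mv (n m) (Z m) (\<lambda>k. u (prod_encode (m, k))) i else 0)"

lemma bsq_nonneg: "0 \<le> bsq n u m"
  by (simp add: bsq_def sum_nonneg)

lemma bsq_scale: "bsq n (\<lambda>k. a * u k) m = (norm a)\<^sup>2 * bsq n u m"
  by (simp add: bsq_def norm_mult power_mult_distrib sum_distrib_left)

lemma bsq_add_le: "bsq n (\<lambda>k. u k + v k) m \<le> 2 * bsq n u m + 2 * bsq n v m"
proof -
  have "(norm (x + y))\<^sup>2 \<le> 2 * (norm x)\<^sup>2 + 2 * (norm y)\<^sup>2" for x y :: 'a
  proof -
    have "(norm (x + y))\<^sup>2 \<le> (norm x + norm y)\<^sup>2" by (intro power_mono norm_triangle_ineq) simp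
    also have "\<dots> \<le> 2 * (norm x)\<^sup>2 + 2 * (norm y)\<^sup>2"
      using sum_squares_bound[of "norm x" "norm y"] by (simp add: power2_sum)
    finally show ?thesis .
  qed
  then show ?thesis
    unfolding bsq_def sum_distrib_left sum.distrib[symmetric] by (intro sum_mono)
qed

lemma ell2_zero: "(\<lambda>k. 0) \<in> ell2 n"
  by (simp add: ell2_def bsq_def[abs_def])

lemma ell2_add:
  assumes "u \<in> ell2 n" "v \<in> ell2 n"
  shows "(\<lambda>k. u k + v k) \<in> ell2 n"
proof -
  have "summable (\<lambda>m. 2 * bsq n u m + 2 * bsq n v m)"
    using assms by (intro summable_add summable_mult) (auto simp: ell2_def)
  then have "summable (bsq n (\<lambda>k. u k + v k))"
    by (rule summable_comparison_test'[where N = 0]) (simp add: bsq_nonneg bsq_add_le)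
  then show ?thesis using assms by (simp add: ell2_def)
qed

lemma ell2_scale: "u \<in> ell2 n \<Longrightarrow> (\<lambda>k. a * u k) \<in> ell2 n"
  by (simp add: ell2_def bsq_scale[abs_def] summable_mult)

lemma ell2_diff: "u \<in> ell2 n \<Longrightarrow> v \<in> ell2 n \<Longrightarrow> (\<lambda>k. u k - v k) \<in> ell2 n"
  using ell2_add[of u n "\<lambda>k. -1 * v k"] ell2_scale[of v n "-1"] by simp

lemma ell2_unit:
  assumes "i < n m"
  shows "(\<lambda>a. if a = prod_encode (m, i) then 1 else 0) \<in> ell2 n"
proof -
  have "bsq n (\<lambda>a. if a = prod_encode (m, i) then 1 else 0) k = 0" if "k \<noteq> m" for k
    using that by (simp add: bsq_def)
  then have "summable (bsq n (\<lambda>a. if a = prod_encode (m, i) then 1 else 0 :: 'a))"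
    by (intro summable_finite[of "{m}"]) auto
  then show ?thesis using assms by (auto simp: ell2_def)
qed

lemma opb_encode: "opb n Z u (prod_encode (m, i))
    = (if i < n m then mv (n m) (Z m) (\<lambda>k. u (prod_encode (m, k))) i else 0)"
  by (simp add: opb_def)

text \<open>Cauchy-Schwarz in each row: the Hilbert-Schmidt norm of a block dominates its operator
  norm.\<close>

lemma bsq_opb_le:
  assumes "(\<Sum>i<n m. \<Sum>k<n m. (norm (Z m i k))\<^sup>2) \<le> 1"
  shows "bsq n (opb n Z u) m \<le> bsq n u m"
proof -
  have row: "(norm (mv (n m) (Z m) (\<lambda>k. u (prod_encode (m, k))) i))\<^sup>2
      \<le> (\<Sum>k<n m. (norm (Z m i k))\<^sup>2) * bsq n u m" for i
  proof -
    have "norm (mv (n m) (Z m) (\<lambda>k. u (prod_encode (m, k))) i)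
        \<le> (\<Sum>k<n m. norm (Z m i k) * norm (u (prod_encode (m, k))))"
      unfolding mv_def by (rule order_trans[OF norm_sum]) (simp add: norm_mult)
    then have "(norm (mv (n m) (Z m) (\<lambda>k. u (prod_encode (m, k))) i))\<^sup>2
        \<le> (\<Sum>k<n m. norm (Z m i k) * norm (u (prod_encode (m, k))))\<^sup>2"
      by (rule power_mono) simp
    also have "\<dots> \<le> (\<Sum>k<n m. (norm (Z m i k))\<^sup>2) * bsq n u m"
      unfolding bsq_def by (rule Cauchy_Schwarz_ineq_sum)
    finally show ?thesis .
  qed
  have "bsq n (opb n Z u) m \<le> (\<Sum>i<n m. (\<Sum>k<n m. (norm (Z m i k))\<^sup>2) * bsq n u m)"
    unfolding bsq_def[of n "opb n Z u"] by (intro sum_mono) (use row in \<open>simp add: opb_encode\<close>)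
  also have "\<dots> = (\<Sum>i<n m. \<Sum>k<n m. (norm (Z m i k))\<^sup>2) * bsq n u m"
    by (simp add: sum_distrib_right)
  also have "\<dots> \<le> 1 * bsq n u m" by (intro mult_right_mono assms bsq_nonneg)
  finally show ?thesis by simp
qed

context conj_field
begin

definition bip :: "(nat \<Rightarrow> nat) \<Rightarrow> (nat \<Rightarrow> 'f) \<Rightarrow> (nat \<Rightarrow> 'f) \<Rightarrow> nat \<Rightarrow> 'f" where
  "bip n u v m = (\<Sum>i<n m. u (prod_encode (m, i)) * c (v (prod_encode (m, i))))"

definition ell2_ip :: "(nat \<Rightarrow> nat) \<Rightarrow> (nat \<Rightarrow> 'f) \<Rightarrow> (nat \<Rightarrow> 'f) \<Rightarrow> 'f" where
  "ell2_ip n u v = suminf (bip n u v)"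

lemma summable_bip:
  assumes "u \<in> ell2 n" "v \<in> ell2 n"
  shows "summable (bip n u v)"
proof -
  have "norm (bip n u v m) \<le> bsq n u m + bsq n v m" for m
  proof -
    have "norm (bip n u v m) \<le> (\<Sum>i<n m. norm (u (prod_encode (m, i))) * norm (v (prod_encode (m, i))))"
      unfolding bip_def by (rule order_trans[OF norm_sum]) (simp add: norm_mult)
    also have "\<dots> \<le> bsq n u m + bsq n v m"
      unfolding bsq_def sum.distrib[symmetric]
    proof (rule sum_mono)
      fix i
      let ?x = "norm (u (prod_encode (m, i)))" and ?y = "norm (v (prod_encode (m, i)))"
      have "2 * (?x * ?y) \<le> ?x\<^sup>2 + ?y\<^sup>2" using sum_squares_bound[of ?x ?y] by simp
      moreover have "0 \<le> ?x * ?y" by simp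
      ultimately show "?x * ?y \<le> ?x\<^sup>2 + ?y\<^sup>2" by linarith
    qed
    finally show ?thesis .
  qed
  moreover have "summable (\<lambda>m. bsq n u m + bsq n v m)"
    using assms by (intro summable_add) (auto simp: ell2_def)
  ultimately show ?thesis by (auto intro: summable_comparison_test'[where N = 0 and g = "\<lambda>m. bsq n u m + bsq n v m"])
qed

lemma ell2_ip_self:
  assumes "u \<in> ell2 n"
  shows "ell2_ip n u u = of_real (suminf (bsq n u))"
proof -
  have "bip n u u = (\<lambda>m. of_real (bsq n u m))"
    by (simp add: fun_eq_iff bip_def bsq_def mult_c)
  then have "ell2_ip n u u = (\<Sum>m. of_real (bsq n u m))" by (simp add: ell2_ip_def)
  also have "\<dots> = of_real (suminf (bsq n u))"
    using assms by (intro suminf_of_real[symmetric]) (simp add: ell2_def)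
  finally show ?thesis .
qed

lemma suminf_bsq_nonneg: "u \<in> ell2 n \<Longrightarrow> 0 \<le> suminf (bsq n u)"
  by (intro suminf_nonneg) (auto simp: ell2_def bsq_nonneg)

lemma hnorm_ell2: "u \<in> ell2 n \<Longrightarrow> hnorm (ell2_ip n) u = sqrt (suminf (bsq n u))"
  using suminf_bsq_nonneg[of u n] by (simp add: hnorm_def ell2_ip_self)

lemma bounded_linear_c: "bounded_linear c"
  by (rule bounded_linear_intro[where K = 1]) (auto simp: c_add scaleR_conv_of_real c_mult)

text \<open>Conjugation is additive, commutes with real scalars and preserves the norm, so it is
  continuous and passes through the infinite sum.\<close>

lemma ell2_ip_commute:
  assumes "u \<in> ell2 n" "v \<in> ell2 n"
  shows "ell2_ip n v u = c (ell2_ip n u v)"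
proof -
  have "(\<lambda>m. c (bip n u v m)) = bip n v u"
    by (simp add: fun_eq_iff bip_def c_sum c_mult mult.commute)
  then show ?thesis
    using bounded_linear.suminf[OF bounded_linear_c summable_bip[OF assms]] by (simp add: ell2_ip_def)
qed

lemma coordinate_le_ell2:
  assumes "u \<in> ell2 n" "i < n m"
  shows "norm (u (prod_encode (m, i))) \<le> hnorm (ell2_ip n) u"
proof -
  have "(norm (u (prod_encode (m, i))))\<^sup>2 \<le> bsq n u m"
    unfolding bsq_def using assms(2) by (intro member_le_sum) auto
  also have "\<dots> \<le> suminf (bsq n u)"
    using sum_le_suminf[of "bsq n u" "{m}"] assms(1) by (simp add: ell2_def bsq_nonneg)
  finally show ?thesis using assms(1) by (simp add: hnorm_ell2 real_le_rsqrt)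
qed

text \<open>Each coordinate is dominated by the norm and so converges. The Cauchy bound on finite
  partial sums passes to the coordinatewise limit, which gives both membership of the limit and
  convergence in norm.\<close>

lemma ell2_complete:
  assumes s: "\<And>k. s k \<in> ell2 n"
    and cauchy: "\<And>e. e > 0 \<Longrightarrow> \<exists>N. \<forall>p\<ge>N. \<forall>q\<ge>N. hnorm (ell2_ip n) (\<lambda>a. s p a - s q a) < e"
  shows "\<exists>l\<in>ell2 n. (\<lambda>p. hnorm (ell2_ip n) (\<lambda>a. s p a - l a)) \<longlonglongrightarrow> 0"
proof -
  have "convergent (\<lambda>p. s p a)" for a
  proof -
    obtain m i where a: "a = prod_encode (m, i)" by (metis prod_decode_inverse surj_pair)
    show ?thesis
    proof (cases "i < n m")
      case True
      have "Cauchy (\<lambda>p. s p a)"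
      proof (rule CauchyI)
        fix e :: real assume "e > 0"
        then obtain N where N: "\<And>p q. p \<ge> N \<Longrightarrow> q \<ge> N \<Longrightarrow> hnorm (ell2_ip n) (\<lambda>a. s p a - s q a) < e"
          using cauchy by meson
        have "norm (s p a - s q a) < e" if "p \<ge> N" "q \<ge> N" for p q
          using coordinate_le_ell2[OF ell2_diff[OF s s], of i m p q] True N[OF that] a by simp
        then show "\<exists>N. \<forall>p\<ge>N. \<forall>q\<ge>N. norm (s p a - s q a) < e" by blast
      qed
      then show ?thesis by (rule Cauchy_convergent)
    next
      case False
      then have "s p a = 0" for p using s[of p] a by (simp add: ell2_def)
      then show ?thesis by (simp add: convergent_const)
    qed
  qed
  then obtain l where l: "\<And>a. (\<lambda>p. s p a) \<longlonglongrightarrow> l a"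
    unfolding convergent_def by metis
  have close: "(\<lambda>a. s p a - l a) \<in> ell2 n \<and> suminf (bsq n (\<lambda>a. s p a - l a)) \<le> e\<^sup>2"
    if e: "e > 0" and p: "p \<ge> N"
      and N: "\<And>p q. p \<ge> N \<Longrightarrow> q \<ge> N \<Longrightarrow> hnorm (ell2_ip n) (\<lambda>a. s p a - s q a) < e" for e p N
  proof -
    have part: "(\<Sum>m<M. bsq n (\<lambda>a. s p a - l a) m) \<le> e\<^sup>2" for M
    proof (rule LIMSEQ_le_const2)
      show "(\<lambda>q. \<Sum>m<M. bsq n (\<lambda>a. s p a - s q a) m) \<longlonglongrightarrow> (\<Sum>m<M. bsq n (\<lambda>a. s p a - l a) m)"
        unfolding bsq_def by (intro tendsto_intros l)
      have "(\<Sum>m<M. bsq n (\<lambda>a. s p a - s q a) m) \<le> e\<^sup>2" if q: "q \<ge> N" for q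
      proof -
        have d: "(\<lambda>a. s p a - s q a) \<in> ell2 n" by (rule ell2_diff[OF s s])
        have "(\<Sum>m<M. bsq n (\<lambda>a. s p a - s q a) m) \<le> suminf (bsq n (\<lambda>a. s p a - s q a))"
          using d by (intro sum_le_suminf) (auto simp: ell2_def bsq_nonneg)
        also have "\<dots> = (hnorm (ell2_ip n) (\<lambda>a. s p a - s q a))\<^sup>2"
          using suminf_bsq_nonneg[OF d] by (simp add: hnorm_ell2[OF d])
        also have "\<dots> \<le> e\<^sup>2"
          using N[OF p q] suminf_bsq_nonneg[OF d] by (intro power_mono) (auto simp: hnorm_ell2[OF d])
        finally show ?thesis .
      qed
      then show "\<exists>N. \<forall>q\<ge>N. (\<Sum>m<M. bsq n (\<lambda>a. s p a - s q a) m) \<le> e\<^sup>2" by blast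
    qed
    have sm: "summable (bsq n (\<lambda>a. s p a - l a))"
      by (rule summableI_nonneg_bounded[OF bsq_nonneg part])
    moreover have "s p (prod_encode (m, i)) - l (prod_encode (m, i)) = 0" if "n m \<le> i" for m i
    proof -
      have "s q (prod_encode (m, i)) = 0" for q using s[of q] that by (simp add: ell2_def)
      then show ?thesis using l[of "prod_encode (m, i)"] by (simp add: LIMSEQ_const_iff)
    qed
    ultimately show ?thesis using suminf_le_const[OF sm part] by (simp add: ell2_def)
  qed
  have "l \<in> ell2 n"
  proof -
    obtain N where N: "\<And>p q. p \<ge> N \<Longrightarrow> q \<ge> N \<Longrightarrow> hnorm (ell2_ip n) (\<lambda>a. s p a - s q a) < 1"
      using cauchy[of 1] by auto
    have "(\<lambda>a. s N a - l a) \<in> ell2 n" using close[of 1 N N] N by auto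
    from ell2_diff[OF s[of N] this] show ?thesis by simp
  qed
  moreover have "(\<lambda>p. hnorm (ell2_ip n) (\<lambda>a. s p a - l a)) \<longlonglongrightarrow> 0"
  proof (rule LIMSEQ_I)
    fix r :: real assume "r > 0"
    then have e: "r / 2 > 0" by simp
    then obtain N where N: "\<And>p q. p \<ge> N \<Longrightarrow> q \<ge> N \<Longrightarrow> hnorm (ell2_ip n) (\<lambda>a. s p a - s q a) < r / 2"
      using cauchy by meson
    have "norm (hnorm (ell2_ip n) (\<lambda>a. s p a - l a) - 0) < r" if p: "p \<ge> N" for p
    proof -
      note cl = close[OF e p N]
      then have d: "(\<lambda>a. s p a - l a) \<in> ell2 n" by blast
      have "hnorm (ell2_ip n) (\<lambda>a. s p a - l a) \<le> r / 2"
        unfolding hnorm_ell2[OF d] using cl e by (intro real_le_lsqrt) auto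
      moreover have "0 \<le> hnorm (ell2_ip n) (\<lambda>a. s p a - l a)" by (simp add: hnorm_def)
      ultimately show ?thesis using \<open>r > 0\<close> by simp
    qed
    then show "\<exists>N. \<forall>p\<ge>N. norm (hnorm (ell2_ip n) (\<lambda>a. s p a - l a) - 0) < r" by blast
  qed
  ultimately show ?thesis by blast
qed

lemma hilbert_space_ell2: "hilbert_space c (ell2 n) (ell2_ip n)"
  unfolding hilbert_space_def
proof (intro conjI ballI allI impI)
  fix u v w :: "nat \<Rightarrow> 'f" and a
  assume u: "u \<in> ell2 n"
  show "(\<lambda>k. a * u k) \<in> ell2 n" by (rule ell2_scale[OF u])
  show "\<exists>r\<ge>0. ell2_ip n u u = of_real r" using ell2_ip_self[OF u] suminf_bsq_nonneg[OF u] by blast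
  show "u = (\<lambda>k. 0)" if "ell2_ip n u u = 0"
  proof
    fix a
    obtain m i where a: "a = prod_encode (m, i)" by (metis prod_decode_inverse surj_pair)
    have "hnorm (ell2_ip n) u = 0" using that by (simp add: hnorm_def)
    then show "u a = 0"
      using coordinate_le_ell2[OF u, of i m] u a by (cases "i < n m") (auto simp: ell2_def)
  qed
  assume v: "v \<in> ell2 n"
  show "(\<lambda>k. u k + v k) \<in> ell2 n" by (rule ell2_add[OF u v])
  show "ell2_ip n v u = c (ell2_ip n u v)" by (rule ell2_ip_commute[OF u v])
  have "bip n (\<lambda>k. a * u k) v = (\<lambda>m. a * bip n u v m)"
    by (simp add: fun_eq_iff bip_def sum_distrib_left mult.assoc)
  then show "ell2_ip n (\<lambda>k. a * u k) v = a * ell2_ip n u v"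
    using suminf_mult[OF summable_bip[OF u v], of a] by (simp add: ell2_ip_def)
  assume w: "w \<in> ell2 n"
  have "bip n (\<lambda>k. u k + v k) w = (\<lambda>m. bip n u w m + bip n v w m)"
    by (simp add: fun_eq_iff bip_def algebra_simps sum.distrib)
  then show "ell2_ip n (\<lambda>k. u k + v k) w = ell2_ip n u w + ell2_ip n v w"
    using suminf_add[OF summable_bip[OF u w] summable_bip[OF v w]]
    by (simp add: ell2_ip_def)
next
  fix s :: "nat \<Rightarrow> nat \<Rightarrow> 'f" assume "(\<forall>k. s k \<in> ell2 n) \<and>
      (\<forall>e>0. \<exists>N. \<forall>p\<ge>N. \<forall>q\<ge>N. hnorm (ell2_ip n) (\<lambda>a. s p a - s q a) < e)"
  then show "\<exists>l\<in>ell2 n. (\<lambda>p. hnorm (ell2_ip n) (\<lambda>a. s p a - l a)) \<longlonglongrightarrow> 0"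
    by (intro ell2_complete) auto
qed (rule ell2_zero)

lemma opb_ell2:
  assumes "\<And>m. (\<Sum>i<n m. \<Sum>k<n m. (norm (Z m i k))\<^sup>2) \<le> 1" "u \<in> ell2 n"
  shows "opb n Z u \<in> ell2 n" "hnorm (ell2_ip n) (opb n Z u) \<le> hnorm (ell2_ip n) u"
proof -
  have le: "bsq n (opb n Z u) m \<le> bsq n u m" for m by (rule bsq_opb_le) (rule assms)
  have su: "summable (bsq n u)" using assms(2) by (simp add: ell2_def)
  then have so: "summable (bsq n (opb n Z u))"
    by (rule summable_comparison_test'[where N = 0]) (simp add: le bsq_nonneg)
  then show o: "opb n Z u \<in> ell2 n" by (simp add: ell2_def opb_encode)
  show "hnorm (ell2_ip n) (opb n Z u) \<le> hnorm (ell2_ip n) u"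
    unfolding hnorm_ell2[OF o] hnorm_ell2[OF assms(2)]
    by (intro real_sqrt_le_mono suminf_le le so su)
qed

lemma bounded_op_opb:
  assumes "\<And>m. (\<Sum>i<n m. \<Sum>k<n m. (norm (Z m i k))\<^sup>2) \<le> 1"
  shows "bounded_op (ell2 n) (ell2_ip n) (opb n Z)"
  unfolding bounded_op_def
proof (intro conjI ballI allI)
  show "opb n Z u \<in> ell2 n" if "u \<in> ell2 n" for u by (rule opb_ell2(1)[OF assms that])
  show "opb n Z (\<lambda>k. u k + v k) = (\<lambda>k. opb n Z u k + opb n Z v k)" for u v
    by (auto simp: opb_def mv_def algebra_simps sum.distrib split: prod.split)
  show "opb n Z (\<lambda>k. a * u k) = (\<lambda>k. a * opb n Z u k)" for a u
    by (auto simp: opb_def mv_def algebra_simps sum_distrib_left split: prod.split)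
  show "\<exists>K. \<forall>u\<in>ell2 n. hnorm (ell2_ip n) (opb n Z u) \<le> K * hnorm (ell2_ip n) u"
    using opb_ell2(2)[OF assms] by (intro exI[of _ 1]) simp
qed

lemma is_adjoint_opb:
  assumes "\<And>m. (\<Sum>i<n m. \<Sum>k<n m. (norm (Z m i k))\<^sup>2) \<le> 1"
  shows "is_adjoint (ell2 n) (ell2_ip n) (opb n Z) (opb n (\<lambda>m. madj c (Z m)))"
  unfolding is_adjoint_def
proof (intro conjI ballI)
  have "(\<Sum>i<n m. \<Sum>k<n m. (norm (madj c (Z m) i k))\<^sup>2) \<le> 1" for m
    by (subst sum.swap) (simp add: madj_def assms)
  then show "opb n (\<lambda>m. madj c (Z m)) u \<in> ell2 n" if "u \<in> ell2 n" for u
    using that by (rule opb_ell2(1))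
  fix u v :: "nat \<Rightarrow> 'f"
  have "bip n (opb n Z u) v m = bip n u (opb n (\<lambda>m. madj c (Z m)) v) m" for m
    using mv_adjoint[of "n m" "Z m" "\<lambda>k. u (prod_encode (m, k))" "\<lambda>k. v (prod_encode (m, k))"]
    by (simp add: bip_def opb_encode)
  then have "bip n (opb n Z u) v = bip n u (opb n (\<lambda>m. madj c (Z m)) v)" by blast
  then show "ell2_ip n (opb n Z u) v = ell2_ip n u (opb n (\<lambda>m. madj c (Z m)) v)"
    by (simp add: ell2_ip_def)
qed

section \<open>Evaluation at block diagonal operators\<close>

lemma op_word_opb:
  fixes Z :: "nat \<Rightarrow> nat \<Rightarrow> nat \<Rightarrow> nat \<Rightarrow> 'f" and n :: "nat \<Rightarrow> nat"
  defines "X \<equiv> \<lambda>j. opb n (\<lambda>m. Z m j)" and "Y \<equiv> \<lambda>j. opb n (\<lambda>m. madj c (Z m j))"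
  assumes "i < n m"
  shows "op_word X Y w u (prod_encode (m, i))
       = vw (n m) (mletters c (Z m)) w (\<lambda>k. u (prod_encode (m, k))) i"
  using assms(3)
proof (induction w arbitrary: i)
  case (Cons l w)
  have "mv (n m) A (\<lambda>k. op_word X Y w u (prod_encode (m, k)))
      = mv (n m) A (vw (n m) (mletters c (Z m)) w (\<lambda>k. u (prod_encode (m, k))))" for A
    by (rule mv_cong) (rule Cons.IH)
  then show ?case using Cons.prems
    by (cases l) (simp_all add: X_def Y_def opb_encode mletters_simps)
qed simp

text \<open>For the empty word the zero comes from membership of \<open>u\<close> in
  \<open>ell2 n\<close>, for any other word from the default value in \<open>opb\<close>.\<close>

lemma op_word_opb_outside:
  fixes Z :: "nat \<Rightarrow> nat \<Rightarrow> nat \<Rightarrow> nat \<Rightarrow> 'f"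
  assumes "u \<in> ell2 n" "n m \<le> i"
  shows "op_word (\<lambda>j. opb n (\<lambda>m. Z m j)) (\<lambda>j. opb n (\<lambda>m. madj c (Z m j))) w u (prod_encode (m, i)) = 0"
proof (cases w)
  case Nil
  then show ?thesis using assms by (simp add: ell2_def)
next
  case (Cons l v)
  then show ?thesis using assms by (cases l) (simp_all add: opb_encode)
qed

text \<open>The operators act block by block, and unit vectors supported in one block lie in the
  space, so the direct sum vanishes exactly when every block does.\<close>

lemma op_eval_opb_iff:
  fixes Z :: "nat \<Rightarrow> nat \<Rightarrow> nat \<Rightarrow> nat \<Rightarrow> 'f" and n :: "nat \<Rightarrow> nat"
  defines "X \<equiv> \<lambda>j. opb n (\<lambda>m. Z m j)" and "Y \<equiv> \<lambda>j. opb n (\<lambda>m. madj c (Z m j))"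
  shows "(\<forall>u\<in>ell2 n. op_eval p X Y u = (\<lambda>a. 0)) \<longleftrightarrow> (\<forall>m. kills (n m) (mletters c (Z m)) p)"
proof -
  have ev: "op_eval p X Y u (prod_encode (m, i))
      = vev (n m) (mletters c (Z m)) p (\<lambda>k. u (prod_encode (m, k))) i" if "i < n m" for m i u
    unfolding op_eval_def vev_def X_def Y_def
    by (intro sum.cong refl) (simp add: op_word_opb[where n = n and m = m and i = i, OF that])
  show ?thesis
  proof (intro iffI allI ballI)
    fix m assume z: "\<forall>u\<in>ell2 n. op_eval p X Y u = (\<lambda>a. 0)"
    show "kills (n m) (mletters c (Z m)) p"
    proof (rule kills_basis)
      fix i j assume i: "i < n m" and j: "j < n m"
      let ?u = "\<lambda>a. if a = prod_encode (m, j) then 1 else 0 :: 'f"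
      have "?u \<in> ell2 n" by (rule ell2_unit) (rule j)
      then have "op_eval p X Y ?u (prod_encode (m, i)) = 0" using z by simp
      then show "vev (n m) (mletters c (Z m)) p (\<lambda>i. if i = j then 1 else 0) i = 0"
        using ev[OF i, of ?u] by simp
    qed
  next
    fix u :: "nat \<Rightarrow> 'f" assume k: "\<forall>m. kills (n m) (mletters c (Z m)) p" and u: "u \<in> ell2 n"
    show "op_eval p X Y u = (\<lambda>a. 0)"
    proof
      fix a
      obtain m i where a: "a = prod_encode (m, i)" by (metis prod_decode_inverse surj_pair)
      show "op_eval p X Y u a = 0"
      proof (cases "i < n m")
        case True
        then show ?thesis using k a ev[OF True, of u] by (simp add: kills_def)
      next
        case False
        then show ?thesis using a op_word_opb_outside[OF u, of m i]
          by (simp add: op_eval_def X_def Y_def)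
      qed
    qed
  qed
qed

end

section \<open>Separating matrices\<close>

context conj_field
begin

text \<open>The bound does not involve \<open>r\<close>, so one scaling factor will serve all
  parameters at once.\<close>

lemma norm_dbl_le:
  assumes "1 \<le> norm r" "norm r \<le> 2"
  shows "norm (dbl m r M j i k) \<le> norm (M (Lx j) (i mod m) (k mod m)) + norm (M (Ls j) (k mod m) (i mod m))"
proof -
  let ?a = "M (Lx j) (i mod m) (k mod m)" and ?b = "c (M (Ls j) (k mod m) (i mod m))"
  have m: "norm (?a - ?b) \<le> norm ?a + norm ?b" and p: "norm (?a + ?b) \<le> norm ?a + norm ?b"
    by (rule norm_triangle_ineq4) (rule norm_triangle_ineq)
  have "norm (r * (?a - ?b) / 2) = norm r / 2 * norm (?a - ?b)" by (simp add: norm_divide norm_mult)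
  also have "\<dots> \<le> 1 * norm (?a - ?b)" using assms by (intro mult_right_mono) auto
  finally have 1: "norm (r * (?a - ?b) / 2) \<le> norm ?a + norm ?b" using m by simp
  have "norm ((?a - ?b) / (2 * r)) = norm (?a - ?b) / (2 * norm r)" by (simp add: norm_divide norm_mult)
  also have "\<dots> \<le> norm (?a - ?b) / 1" using assms by (intro divide_left_mono) auto
  finally have 2: "norm ((?a - ?b) / (2 * r)) \<le> norm ?a + norm ?b" using m by simp
  have "norm ((?a + ?b) / 2) = norm (?a + ?b) / 2" by (simp add: norm_divide)
  then have 3: "norm ((?a + ?b) / 2) \<le> norm ?a + norm ?b"
    using p norm_ge_zero[of "?a + ?b"] by linarith
  show ?thesis using 1 2 3 by (simp only: dbl_def Let_def norm_c split: if_split) simp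
qed

text \<open>A sequence of genuine matrix tuples whose common annihilator is exactly
  \<open>I\<close>. They serve both as blocks of the Hilbert space operators and as test points for
  the radical.\<close>

lemma separating_matrices:
  assumes S: "S \<subseteq> polys g" "\<And>s. s \<in> S \<Longrightarrow> analytic s \<and> homogeneous s"
    and I: "I = star_ideal_gen g c S" "I \<noteq> polys g"
  obtains n :: "nat \<Rightarrow> nat" and Z :: "nat \<Rightarrow> nat \<Rightarrow> nat \<Rightarrow> nat \<Rightarrow> 'f"
  where "\<And>m. n m \<ge> 1"
    and "\<And>m j. j < g \<Longrightarrow> (\<Sum>i<n m. \<Sum>k<n m. (norm (Z m j i k))\<^sup>2) \<le> 1"
    and "\<And>m q. q \<in> I \<Longrightarrow> kills (n m) (mletters c (Z m)) q"
    and "\<And>p. p \<in> polys g \<Longrightarrow> (\<And>m. kills (n m) (mletters c (Z m)) p) \<Longrightarrow> p \<in> I"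
proof -
  have idl: "star_ideal g c I" unfolding I(1) by (rule star_ideal_gen_star_ideal[OF S(1)])
  have wtI: "wt \<phi> p \<in> I" if "p \<in> I" for \<phi> p
    using that S unfolding I(1) by (intro wt_star_ideal_gen) auto
  have one: "single [] \<notin> I"
  proof
    assume "single [] \<in> I"
    then have "p \<in> I" if "p \<in> polys g" for p using star_idealD(5)[OF idl _ that] by fastforce
    then show False using I(2) star_idealD(1)[OF idl] by blast
  qed
  define good where "good N m M u \<longleftrightarrow> (\<forall>q\<in>I. kills m M q) \<and>
      (\<forall>p\<in>polys g. (\<forall>w. p w \<noteq> 0 \<longrightarrow> length w \<le> N) \<longrightarrow> (\<forall>i<m. vev m M p u i = 0) \<longrightarrow> p \<in> I)"
    for N m M u
  have "\<exists>m M u. good N m M u" for N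
  proof (rule truncated_regular_representation[OF idl wtI, of N])
    fix m M u assume "\<And>q. q \<in> I \<Longrightarrow> kills m M q"
      and "\<And>p. p \<in> polys g \<Longrightarrow> (\<And>w. p w \<noteq> 0 \<Longrightarrow> length w \<le> N) \<Longrightarrow>
           (\<And>i. i < m \<Longrightarrow> vev m M p u i = 0) \<Longrightarrow> p \<in> I"
    then have "good N m M u" by (simp add: good_def)
    then show ?thesis by blast
  qed
  then obtain d M u where good: "\<And>N. good N (d N) (M N) (u N)" by metis
  \<comment> \<open>In dimension 0 every evaluation would vanish vacuously and force 1 into the
    proper ideal.\<close>
  have d: "d N \<ge> 1" for N
  proof (rule ccontr)
    assume "\<not> d N \<ge> 1"
    moreover have "single [] \<in> polys g" by (rule single_polys) simp
    moreover have "\<forall>w. single [] w \<noteq> (0::'f) \<longrightarrow> length w \<le> N" by (simp add: single_def)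
    ultimately have "single [] \<in> I" using good[of N] unfolding good_def by fastforce
    then show False using one by simp
  qed
  \<comment> \<open>Infinitely many positive parameters, whose squares are distinct, within the
    range between 1 and 2 where the entries are uniformly bounded.\<close>
  define \<rho> :: "nat \<Rightarrow> real" where "\<rho> k = 1 + inverse (real (Suc k))" for k
  define r :: "nat \<Rightarrow> 'f" where "r k = of_real (\<rho> k)" for k
  have \<rho>: "1 \<le> \<rho> k" "\<rho> k \<le> 2" for k by (auto simp: \<rho>_def field_simps)
  have r: "r k \<noteq> 0" "c (r k) = r k" "1 \<le> norm (r k)" "norm (r k) \<le> 2" for k
    using \<rho>[of k] by (auto simp: r_def)
  define e where "e N j i l = norm (M N (Lx j) (i mod d N) (l mod d N)) + norm (M N (Ls j) (l mod d N) (i mod d N))"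
    for N j i l
  \<comment> \<open>Summing over all letters yields one factor \<open>\<kappa> N\<close> for the
    whole tuple, so the relations stay homogeneous. The summand 1 in its denominator avoids division
    by zero and gives \<open>\<kappa> N \<le> 1\<close>, whence
    \<open>(\<kappa> N)\<^sup>2 * F N \<le> 1\<close>.\<close>
  define F where "F N = (\<Sum>j<g. \<Sum>i<2 * d N. \<Sum>l<2 * d N. (e N j i l)\<^sup>2)" for N
  define \<kappa> :: "nat \<Rightarrow> real" where "\<kappa> N = inverse (1 + F N)" for N
  have F: "0 \<le> F N" for N unfolding F_def by (intro sum_nonneg) auto
  have \<kappa>: "0 < \<kappa> N" "\<kappa> N \<le> 1" "\<kappa> N * F N \<le> 1" for N
    using F[of N] by (auto simp: \<kappa>_def field_simps)
  define Ms where "Ms N = (\<lambda>l i j. of_real (\<kappa> N) * M N l i j)" for N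
  define Zs where "Zs N k = dbl (d N) (r k) (Ms N)" for N k
  have \<kappa>0: "of_real (\<kappa> N) \<noteq> (0::'f)" for N using \<kappa>(1)[of N] by simp
  have Ms_kills: "kills (d N) (Ms N) q" if "q \<in> I" for N q
  proof -
    have "kills (d N) (M N) (wt (\<lambda>n. of_real (\<kappa> N) ^ n) q)"
      using good[of N] wtI[OF that] by (simp add: good_def)
    then show ?thesis unfolding kills_def Ms_def vev_scale[OF \<kappa>0] .
  qed
  have bound: "(\<Sum>i<2 * d N. \<Sum>l<2 * d N. (norm (Zs N k j i l))\<^sup>2) \<le> 1" if j: "j < g" for N k j
  proof -
    have Z: "norm (Zs N k j i l) \<le> \<kappa> N * e N j i l" for i l
      using norm_dbl_le[OF r(3,4), of "d N" k "Ms N" j i l] \<kappa>(1)[of N]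
      by (simp add: Zs_def Ms_def e_def norm_mult distrib_left)
    have "(\<Sum>i<2 * d N. \<Sum>l<2 * d N. (norm (Zs N k j i l))\<^sup>2)
        \<le> (\<Sum>i<2 * d N. \<Sum>l<2 * d N. (\<kappa> N * e N j i l)\<^sup>2)"
      by (intro sum_mono power_mono Z) simp
    also have "\<dots> = (\<kappa> N)\<^sup>2 * (\<Sum>i<2 * d N. \<Sum>l<2 * d N. (e N j i l)\<^sup>2)"
      by (simp add: power_mult_distrib sum_distrib_left)
    also have "\<dots> \<le> (\<kappa> N)\<^sup>2 * F N"
      unfolding F_def using j
      by (intro mult_left_mono member_le_sum[where f = "\<lambda>j. \<Sum>i<2 * d N. \<Sum>l<2 * d N. (e N j i l)\<^sup>2"])
        (auto intro!: sum_nonneg)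
    also have "\<dots> = \<kappa> N * (\<kappa> N * F N)" by (simp add: power2_eq_square)
    also have "\<dots> \<le> 1 * 1"
      using \<kappa>[of N] F[of N] by (intro mult_mono) auto
    finally show ?thesis by simp
  qed
  have Zs_kills: "kills (2 * d N) (mletters c (Zs N k)) q" if "q \<in> I" for N k q
  proof -
    have "S \<subseteq> {p \<in> polys g. kills (2 * d N) (mletters c (Zs N k)) p}"
    proof
      fix s assume s: "s \<in> S"
      then have sI: "s \<in> I" using star_ideal_gen_superset I(1) by blast
      \<comment> \<open>\<open>I\<close> also contains the star of \<open>s\<close>, and its
        vanishing at \<open>Ms N\<close> is that of \<open>s\<close> at the adjoint assignment. Thus
        both direct summands of the doubled matrices satisfy the generator.\<close>
      have "kills (d N) (mstar (Ms N)) (pstar c (pstar c s))"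
        by (intro kills_pstar Ms_kills star_idealD(4)[OF idl] sI)
      then have "kills (2 * d N) (mletters c (Zs N k)) s"
        unfolding Zs_def using s S(2) by (intro kills_dbl_analytic r Ms_kills sI) auto
      then show "s \<in> {p \<in> polys g. kills (2 * d N) (mletters c (Zs N k)) p}" using s S(1) by auto
    qed
    from star_ideal_gen_least[OF star_ideal_kills this] show ?thesis using that I(1) by blast
  qed
  have sep: "p \<in> I" if p: "p \<in> polys g" and k: "\<And>N k. kills (2 * d N) (mletters c (Zs N k)) p" for p
  proof (rule ccontr)
    assume pI: "p \<notin> I"
    obtain N where N: "\<And>w. p w \<noteq> 0 \<Longrightarrow> length w \<le> N"
      using finite_nat_set_iff_bounded_le[of "length ` {w. p w \<noteq> 0}"] polys_finite[OF p] by auto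
    \<comment> \<open>Evaluating \<open>p\<close> at the scaled matrices is evaluating
      \<open>p'\<close> at the original ones. Gradedness allows the scaling to be undone, so
      \<open>p'\<close> is outside \<open>I\<close> as well.\<close>
    define p' where "p' = wt (\<lambda>n. of_real (\<kappa> N) ^ n) p"
    have "wt (\<lambda>n. inverse (of_real (\<kappa> N) ^ n)) p' = p"
      using \<kappa>0[of N] by (simp add: p'_def wt_def fun_eq_iff field_simps)
    then have "p' \<notin> I" using wtI[of p'] pI by metis
    moreover have "p' \<in> polys g" "\<And>w. p' w \<noteq> 0 \<Longrightarrow> length w \<le> N"
      using wt_polys[OF p] N by (auto simp: p'_def wt_def)
    ultimately obtain i where i: "i < d N" "vev (d N) (M N) p' (u N) i \<noteq> 0"
      using good[of N] unfolding good_def by blast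
    then have "vev (d N) (Ms N) p (u N) i \<noteq> 0" by (simp add: Ms_def vev_scale[OF \<kappa>0] p'_def)
    from kills_dbl_finite[OF i(1) this]
    have "finite {q. \<exists>r. r \<noteq> 0 \<and> c r = r \<and> q = r\<^sup>2 \<and> kills (2 * d N) (mletters c (dbl (d N) r (Ms N))) p}" .
    moreover have "range (\<lambda>k. (r k)\<^sup>2) \<subseteq>
        {q. \<exists>r. r \<noteq> 0 \<and> c r = r \<and> q = r\<^sup>2 \<and> kills (2 * d N) (mletters c (dbl (d N) r (Ms N))) p}"
      using r k[of N] unfolding Zs_def by blast
    ultimately have "finite (range (\<lambda>k. (r k)\<^sup>2))" by (rule rev_finite_subset)
    moreover have "inj (\<lambda>k. (r k)\<^sup>2)"
    proof (rule injI)
      fix k k' assume "(r k)\<^sup>2 = (r k')\<^sup>2"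
      then have "of_real ((\<rho> k)\<^sup>2) = (of_real ((\<rho> k')\<^sup>2) :: 'f)" by (simp add: r_def)
      then have "(\<rho> k)\<^sup>2 = (\<rho> k')\<^sup>2" using of_real_eq_iff by blast
      then have "\<rho> k = \<rho> k'" using \<rho>(1)[of k] \<rho>(1)[of k'] by (simp add: power2_eq_iff_nonneg)
      then show "k = k'" by (simp add: \<rho>_def)
    qed
    ultimately show False using finite_imageD by blast
  qed
  show thesis
  \<comment> \<open>The block index encodes a pair of a degree bound \<open>N\<close> and a
    parameter number \<open>k\<close>.\<close>
  proof (rule that[of "\<lambda>m. 2 * d (fst (prod_decode m))" "\<lambda>m. Zs (fst (prod_decode m)) (snd (prod_decode m))"])
    fix p assume p: "p \<in> polys g" and k: "\<And>m. kills (2 * d (fst (prod_decode m)))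
        (mletters c (Zs (fst (prod_decode m)) (snd (prod_decode m)))) p"
    have "kills (2 * d N) (mletters c (Zs N k)) p" for N k using k[of "prod_encode (N, k)"] by simp
    then show "p \<in> I" by (rule sep[OF p])
  next
    show "1 \<le> 2 * d (fst (prod_decode m))" for m using d[of "fst (prod_decode m)"] by simp
  qed (use bound Zs_kills in auto)
qed

text \<open>Each block is a matrix zero of \<open>I\<close> of positive size, so a polynomial in the
  hard radical vanishes at all blocks and lies in \<open>I\<close>. The same blocks assembled into a
  direct sum give the operator tuple.\<close>

lemma hyp_1_4_imp_concl_1_4:
  assumes "hyp_1_4 g c I"
  shows "concl_1_4 g c I"
proof -
  obtain S where S: "S \<subseteq> polys g" "\<And>s. s \<in> S \<Longrightarrow> analytic s \<and> homogeneous s"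
    and I: "I = star_ideal_gen g c S" "I \<noteq> polys g"
    using assms unfolding hyp_1_4_def by blast
  show ?thesis
  proof (rule separating_matrices[OF S I])
    fix n :: "nat \<Rightarrow> nat" and Z :: "nat \<Rightarrow> nat \<Rightarrow> nat \<Rightarrow> nat \<Rightarrow> 'f"
    assume n: "\<And>m. n m \<ge> 1"
      and bound: "\<And>m j. j < g \<Longrightarrow> (\<Sum>i<n m. \<Sum>k<n m. (norm (Z m j i k))\<^sup>2) \<le> 1"
      and kills: "\<And>m q. q \<in> I \<Longrightarrow> kills (n m) (mletters c (Z m)) q"
      and sep: "\<And>p. p \<in> polys g \<Longrightarrow> (\<And>m. kills (n m) (mletters c (Z m)) p) \<Longrightarrow> p \<in> I"
    have "I \<subseteq> polys g" unfolding I(1) by (rule star_idealD(1)[OF star_ideal_gen_star_ideal[OF S(1)]])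
    then have "hard_rad g c I = I"
      unfolding hard_rad_def mat_zero_iff using n kills sep by blast
    moreover have "\<exists>V ip X Y. hilbert_space c V ip
            \<and> (\<forall>j<g. bounded_op V ip (X j) \<and> is_adjoint V ip (X j) (Y j))
            \<and> (\<forall>p\<in>polys g. (\<forall>u\<in>V. op_eval p X Y u = (\<lambda>n. 0)) \<longleftrightarrow> p \<in> I)"
    proof (intro exI conjI ballI allI impI)
      show "hilbert_space c (ell2 n) (ell2_ip n)" by (rule hilbert_space_ell2)
      show "bounded_op (ell2 n) (ell2_ip n) (opb n (\<lambda>m. Z m j))" if "j < g" for j
        by (rule bounded_op_opb) (rule bound[OF that])
      show "is_adjoint (ell2 n) (ell2_ip n) (opb n (\<lambda>m. Z m j)) (opb n (\<lambda>m. madj c (Z m j)))" if "j < g" for j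
        by (rule is_adjoint_opb) (rule bound[OF that])
      show "(\<forall>u\<in>ell2 n. op_eval p (\<lambda>j. opb n (\<lambda>m. Z m j)) (\<lambda>j. opb n (\<lambda>m. madj c (Z m j))) u = (\<lambda>n. 0)) \<longleftrightarrow> p \<in> I"
        if "p \<in> polys g" for p
        unfolding op_eval_opb_iff using kills sep that by blast
    qed
    ultimately show ?thesis unfolding concl_1_4_def by blast
  qed
qed

end

theorem theorem1p4:
  fixes g :: nat
  shows "(\<forall>I::(ltr list \<Rightarrow> real) set. hyp_1_4 g id I \<longrightarrow> concl_1_4 g id I)
       \<and> (\<forall>I::(ltr list \<Rightarrow> complex) set. hyp_1_4 g cnj I \<longrightarrow> concl_1_4 g cnj I)"
proof -
  interpret r: conj_field "id :: real \<Rightarrow> real"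
    by unfold_locales (auto simp: power2_eq_square)
  interpret c: conj_field cnj
    by unfold_locales (simp_all only: complex_cnj_add complex_cnj_mult complex_cnj_cnj complex_norm_square)
  show ?thesis using r.hyp_1_4_imp_concl_1_4 c.hyp_1_4_imp_concl_1_4 by blast
qed

end
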